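(* Let $m,p\in\mathbb{N}$ and let $\{A_j\}_{j=-m}^{p}$ be a (strictly) increasing sequence of real numbers with $A_0=0$. Let $N_j\in\mathbb{N}$ for $-m\le j\le p$, $j\ne0$, and let $N_0=\infty$. Let $\{d_i\}_{i=1}^\infty$ be a sequence in $[A_{-m},A_p]$. There is a finite rank self-adjoint operator $E$ with diagonal $\{d_i\}_{i=1}^\infty$ and eigenvalue-multiplicity list $\{(A_j,N_j)\}_{j=-m}^{p}$ if and only if the following three conditions hold: (i) for each $r=-m,-m+1,\dots,0$, $\displaystyle\sum_{d_i\le A_r}(A_r-d_i)\le\sum_{j=-m}^{r-1}N_j(A_r-A_j)$; (ii) for each $r=0,1,\dots,p$, $\displaystyle\sum_{d_i\ge A_r}(d_i-A_r)\le\sum_{j=r+1}^{p}N_j(A_j-A_r)$; (iii) $\displaystyle\sum_{i=1}^\infty d_i=\sum_{j=-m}^{-1}N_jA_j+\sum_{j=1}^{p}N_jA_j$.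
   Context: Here $\mathbb{N}=\{1,2,\dots\}$. For a bounded operator $E$ and scalar $\lambda$, $m_E(\lambda)=\dim\ker(E-\lambda)$. An operator $E$ has eigenvalue-multiplicity list $\{(A_j,N_j)\}_{j=-m}^{p}$ if $\sigma(E)=\{A_{-m},\dots,A_p\}$ and $m_E(A_j)=N_j$ for all $j$. An operator $E$ on a Hilbert space $\mathcal{H}$ has diagonal $\{d_i\}_{i=1}^\infty$ if there is an orthonormal basis $\{e_i\}_{i=1}^\infty$ of $\mathcal{H}$ with $\langle Ee_i,e_i\rangle=d_i$ for all $i$. Empty sums are $0$. *)

theory Defs
  imports "HOL-Analysis.Analysis"
begin

text \<open>
  The inner product is linear in its first and conjugate linear in its second argument.
  Positive definiteness follows from the last axiom and the axioms for the norm
  in \<^class>\<open>banach\<close>; note that \<^const>\<open>sqrt\<close> is negative on negative arguments.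
\<close>

class complex_hilbert_space = banach +
  fixes scaleC :: "complex \<Rightarrow> 'a \<Rightarrow> 'a"  (infixr \<open>*\<^sub>C\<close> 75)
    and cinner :: "'a \<Rightarrow> 'a \<Rightarrow> complex"
  assumes scaleC_add_right: "c *\<^sub>C (x + y) = c *\<^sub>C x + c *\<^sub>C y"
    and scaleC_add_left: "(b + c) *\<^sub>C x = b *\<^sub>C x + c *\<^sub>C x"
    and scaleC_scaleC: "b *\<^sub>C c *\<^sub>C x = (b * c) *\<^sub>C x"
    and scaleC_one: "1 *\<^sub>C x = x"
    and scaleR_eq_scaleC: "r *\<^sub>R x = complex_of_real r *\<^sub>C x"
    and cinner_commute: "cinner x y = cnj (cinner y x)"
    and cinner_add_left: "cinner (x + y) z = cinner x z + cinner y z"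
    and cinner_scaleC_left: "cinner (c *\<^sub>C x) y = c * cinner x y"
    and norm_eq_sqrt_cinner: "norm x = sqrt (Re (cinner x x))"

global_interpretation complex_vector:
  vector_space "scaleC :: complex \<Rightarrow> 'a \<Rightarrow> 'a::complex_hilbert_space"
  defines cspan_raw_def: cspan = complex_vector.span
    and cdim_raw_def: cdim = complex_vector.dim
  by unfold_locales
    (simp_all add: scaleC_add_right scaleC_add_left scaleC_scaleC scaleC_one)

definition finite_dimensional :: "'a::complex_hilbert_space set \<Rightarrow> bool" where
  "finite_dimensional V \<longleftrightarrow> (\<exists>B. finite B \<and> V \<subseteq> cspan B)"

text \<open>\<^const>\<open>cdim\<close> is \<open>0\<close> on infinite-dimensional subspaces.\<close>

definition edim :: "'a::complex_hilbert_space set \<Rightarrow> enat" where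
  "edim V = (if finite_dimensional V then enat (cdim V) else \<infinity>)"

definition orthonormal_basis :: "(nat \<Rightarrow> 'a::complex_hilbert_space) \<Rightarrow> bool" where
  "orthonormal_basis e \<longleftrightarrow>
     (\<forall>i j. cinner (e i) (e j) = (if i = j then 1 else 0)) \<and>
     closure (cspan (range e)) = UNIV"

definition bounded_operator :: "('a::complex_hilbert_space \<Rightarrow> 'a) \<Rightarrow> bool" where
  "bounded_operator E \<longleftrightarrow> bounded_linear E \<and> (\<forall>c x. E (c *\<^sub>C x) = c *\<^sub>C E x)"

definition self_adjoint :: "('a::complex_hilbert_space \<Rightarrow> 'a) \<Rightarrow> bool" where
  "self_adjoint E \<longleftrightarrow> bounded_operator E \<and> (\<forall>x y. cinner (E x) y = cinner x (E y))"

definition finite_rank :: "('a::complex_hilbert_space \<Rightarrow> 'a) \<Rightarrow> bool" where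
  "finite_rank E \<longleftrightarrow> finite_dimensional (range E)"

definition spectrum :: "('a::complex_hilbert_space \<Rightarrow> 'a) \<Rightarrow> complex set" where
  "spectrum E = {\<mu>. \<not> (\<exists>R. bounded_operator R \<and>
     (\<forall>x. R (E x - \<mu> *\<^sub>C x) = x) \<and> (\<forall>x. E (R x) - \<mu> *\<^sub>C R x = x))}"

definition multiplicity_of :: "('a::complex_hilbert_space \<Rightarrow> 'a) \<Rightarrow> complex \<Rightarrow> enat" where
  "multiplicity_of E \<mu> = edim {x. E x - \<mu> *\<^sub>C x = 0}"

definition has_eigenvalue_multiplicity_list ::
    "('a::complex_hilbert_space \<Rightarrow> 'a) \<Rightarrow> int set \<Rightarrow> (int \<Rightarrow> real) \<Rightarrow> (int \<Rightarrow> enat) \<Rightarrow> bool" where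
  "has_eigenvalue_multiplicity_list E J A N \<longleftrightarrow>
     spectrum E = (\<lambda>j. complex_of_real (A j)) ` J \<and>
     (\<forall>j\<in>J. multiplicity_of E (complex_of_real (A j)) = N j)"

definition has_diagonal :: "('a::complex_hilbert_space \<Rightarrow> 'a) \<Rightarrow> (nat \<Rightarrow> real) \<Rightarrow> bool" where
  "has_diagonal E d \<longleftrightarrow>
     (\<exists>e. orthonormal_basis e \<and> (\<forall>i. cinner (E (e i)) (e i) = complex_of_real (d i)))"

end

theory Submission
  imports Defs "HOL-Computational_Algebra.Fundamental_Theorem_Algebra"
begin

text \<open>
  Diagonalising \<open>E = (\<Sum>k. a\<^sub>k \<langle>\<cdot>, v\<^sub>k\<rangle> v\<^sub>k)\<close> over its nonzero eigenvalues, the diagonal in a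
  basis \<open>e\<close> is \<open>d\<^sub>i = (\<Sum>k. a\<^sub>k \<bar>\<langle>e\<^sub>i, v\<^sub>k\<rangle>\<bar>\<^sup>2)\<close>. The weights sum to \<open>1\<close> over \<open>i\<close> (Parseval) and to at
  most \<open>1\<close> over \<open>k\<close> (Bessel), which gives the trace formula and, for \<open>x \<ge> 0\<close>, the
  inequality \<open>(\<Sum>i. (d\<^sub>i - x)\<^sup>+) \<le> (\<Sum>k. (a\<^sub>k - x)\<^sup>+)\<close>; negating everything gives the other side.

  Conversely, only finitely many entries of \<open>d\<close> matter: a nonnegative tail of small sum \<open>s\<close> is the
  diagonal of a rank one operator with eigenvalue \<open>s\<close>, and likewise a negative one. Replacing both
  tails by their sums leaves a finite problem of Schur--Horn type. Its hypothesis, majorization, is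
  an inequality between a convex function of \<open>x\<close> and one that is affine between consecutive
  eigenvalues, so it suffices to have it at the eigenvalues; there it is not affected by the
  replacement, as the tail sums lie below all positive and above all negative eigenvalues.
\<close>

subsection \<open>Majorization and the finite Schur--Horn theorem\<close>

text \<open>As a function of \<open>x\<close>, the left side is convex, hence below its chord over
  \<open>[\<alpha>, \<beta>]\<close>; the right side is affine there, since no \<open>a k\<close>
  lies strictly inside, hence equal to its chord. So the inequality at both ends gives it in
  between.\<close>

lemma pos_part_sum_le_between:
  fixes c :: "'i \<Rightarrow> real" and a :: "'k \<Rightarrow> real"
  assumes x: "\<alpha> \<le> x" "x \<le> \<beta>"
    and gap: "\<And>k. k \<in> K \<Longrightarrow> a k \<le> \<alpha> \<or> \<beta> \<le> a k"
    and le_alpha: "(\<Sum>i\<in>I. max 0 (c i - \<alpha>)) \<le> (\<Sum>k\<in>K. max 0 (a k - \<alpha>))"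
    and le_beta: "(\<Sum>i\<in>I. max 0 (c i - \<beta>)) \<le> (\<Sum>k\<in>K. max 0 (a k - \<beta>))"
  shows "(\<Sum>i\<in>I. max 0 (c i - x)) \<le> (\<Sum>k\<in>K. max 0 (a k - x))"
proof (cases "\<alpha> = \<beta>")
  case True
  with x le_alpha show ?thesis by simp
next
  case False
  with x have lt: "0 < \<beta> - \<alpha>" by simp
  \<comment> \<open>Chord bound for a single summand, multiplied by
    \<open>\<beta> - \<alpha>\<close> to avoid division.\<close>
  have cvx: "(\<beta> - \<alpha>) * max 0 (t - x) \<le> (\<beta> - x) * max 0 (t - \<alpha>) + (x - \<alpha>) * max 0 (t - \<beta>)" for t
  proof (cases "t \<le> x")
    case True
    then show ?thesis using x by simp
  next
    case False
    then have "(\<beta> - \<alpha>) * max 0 (t - x) = (\<beta> - x) * (t - \<alpha>) + (x - \<alpha>) * (t - \<beta>)"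
      by (simp add: algebra_simps)
    also have "\<dots> \<le> (\<beta> - x) * max 0 (t - \<alpha>) + (x - \<alpha>) * max 0 (t - \<beta>)"
      using x by (intro add_mono mult_left_mono) auto
    finally show ?thesis .
  qed
  have aff: "(\<beta> - \<alpha>) * max 0 (a k - x) = (\<beta> - x) * max 0 (a k - \<alpha>) + (x - \<alpha>) * max 0 (a k - \<beta>)"
    if "k \<in> K" for k
    using gap[OF that]
  proof
    assume "a k \<le> \<alpha>"
    then show ?thesis using x by (simp add: max_absorb1)
  next
    assume "\<beta> \<le> a k"
    then show ?thesis using x by (simp add: algebra_simps)
  qed
  have "(\<beta> - \<alpha>) * (\<Sum>i\<in>I. max 0 (c i - x))
      \<le> (\<beta> - x) * (\<Sum>i\<in>I. max 0 (c i - \<alpha>)) + (x - \<alpha>) * (\<Sum>i\<in>I. max 0 (c i - \<beta>))"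
    unfolding sum_distrib_left sum.distrib[symmetric] by (rule sum_mono) (rule cvx)
  also have "\<dots> \<le> (\<beta> - x) * (\<Sum>k\<in>K. max 0 (a k - \<alpha>)) + (x - \<alpha>) * (\<Sum>k\<in>K. max 0 (a k - \<beta>))"
    using x le_alpha le_beta by (intro add_mono mult_left_mono) auto
  also have "\<dots> = (\<beta> - \<alpha>) * (\<Sum>k\<in>K. max 0 (a k - x))"
    unfolding sum_distrib_left sum.distrib[symmetric] by (rule sum.cong) (simp_all add: aff)
  finally show ?thesis using lt by simp
qed

text \<open>\<open>X\<close> contains every kink of the right side, which is therefore affine
  between consecutive elements of \<open>X\<close>. Beyond \<open>Max X\<close> the right side
  vanishes, and the left side, nonincreasing in \<open>x\<close>, has vanished already.\<close>

lemma pos_part_sum_le_if_le_at_kinks: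
  fixes c :: "'i \<Rightarrow> real" and a :: "'k \<Rightarrow> real" and X :: "real set"
  assumes X: "finite X" "0 \<in> X" "\<And>k. k \<in> K \<Longrightarrow> a k \<in> X"
    and kinks: "\<And>y. y \<in> X \<Longrightarrow> 0 \<le> y \<Longrightarrow>
      (\<Sum>i\<in>I. max 0 (c i - y)) \<le> (\<Sum>k\<in>K. max 0 (a k - y))"
    and x: "0 \<le> x"
  shows "(\<Sum>i\<in>I. max 0 (c i - x)) \<le> (\<Sum>k\<in>K. max 0 (a k - x))"
proof (cases "Max X \<le> x")
  case True
  have "Max X \<in> X" using X by (auto intro: Max_in)
  have "(\<Sum>i\<in>I. max 0 (c i - x)) \<le> (\<Sum>i\<in>I. max 0 (c i - Max X))"
    using True by (intro sum_mono) auto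
  also have "\<dots> \<le> (\<Sum>k\<in>K. max 0 (a k - Max X))"
    using X \<open>Max X \<in> X\<close> by (intro kinks) auto
  also have "\<dots> = (\<Sum>k\<in>K. max 0 (a k - x))"
    using X True by (intro sum.cong refl) (smt (verit) Max_ge)
  finally show ?thesis .
next
  case False
  \<comment> \<open>The neighbours of \<open>x\<close> in \<open>X\<close>. Since
    \<open>0 \<in> X\<close>, the lower one is nonnegative, so \<open>kinks\<close> applies at
    both.\<close>
  define \<alpha> where "\<alpha> = Max {y \<in> X. y \<le> x}"
  define \<beta> where "\<beta> = Min {y \<in> X. x \<le> y}"
  have "Max X \<in> X" using X by (auto intro: Max_in)
  then have "0 \<in> {y \<in> X. y \<le> x}" "Max X \<in> {y \<in> X. x \<le> y}" using X x False by auto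
  then have ne: "{y \<in> X. y \<le> x} \<noteq> {}" "{y \<in> X. x \<le> y} \<noteq> {}" by blast+
  have \<alpha>: "\<alpha> \<in> {y \<in> X. y \<le> x}" unfolding \<alpha>_def using X ne by (intro Max_in) auto
  have \<beta>: "\<beta> \<in> {y \<in> X. x \<le> y}" unfolding \<beta>_def using X ne by (intro Min_in) auto
  have "0 \<le> \<alpha>" unfolding \<alpha>_def using X x by (intro Max_ge) auto
  moreover have "a k \<le> \<alpha> \<or> \<beta> \<le> a k" if "k \<in> K" for k
  proof (cases "a k \<le> x")
    case True
    then show ?thesis unfolding \<alpha>_def using X that by (auto intro!: Max_ge)
  next
    case False
    then show ?thesis unfolding \<beta>_def using X that by (auto intro!: Min_le)
  qed
  ultimately show ?thesis using \<alpha> \<beta> x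
    by (intro pos_part_sum_le_between[of \<alpha> x \<beta>] kinks) auto
qed

text \<open>\<open>u k\<close> lists the coordinates of a unit eigenvector for \<open>a k\<close>.
  The induction realises one entry \<open>c0\<close> at a time: either \<open>c0\<close> is an
  eigenvalue and splits off, or a plane rotation mixing the two eigenvalues adjacent to
  \<open>c0\<close> produces it and leaves one new eigenvalue for the remaining entries.\<close>

lemma schur_horn_finite:
  fixes c :: "'i \<Rightarrow> real" and a :: "'k \<Rightarrow> real"
  assumes "finite I" "finite K" "card I = card K" "sum c I = sum a K"
    and "\<And>x. (\<Sum>i\<in>I. max 0 (c i - x)) \<le> (\<Sum>k\<in>K. max 0 (a k - x))"
  shows "\<exists>u. (\<forall>k\<in>K. \<forall>l\<in>K. (\<Sum>i\<in>I. u k i * u l i) = (if k = l then 1 else 0)) \<and>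
    (\<forall>i\<in>I. (\<Sum>k\<in>K. a k * (u k i)\<^sup>2) = c i)"
  using assms
proof (induction I arbitrary: K a rule: finite_induct)
  case empty
  then show ?case by simp
next
  case (insert i0 I)
  define c0 where "c0 = c i0"
  have maj: "max 0 (c0 - x) + (\<Sum>i\<in>I. max 0 (c i - x)) \<le> (\<Sum>k\<in>K. max 0 (a k - x))" for x
    using insert.prems(4)[of x] insert.hyps by (simp add: c0_def)
  have tot: "c0 + sum c I = sum a K" using insert.prems insert.hyps by (simp add: c0_def)
  have cardK: "card K = Suc (card I)" using insert.prems insert.hyps by simp
  then have Kne: "K \<noteq> {}" by auto
  note finK = \<open>finite K\<close>
  \<comment> \<open>Otherwise the right side of \<open>maj\<close> vanishes at the largest
    eigenvalue, while \<open>c0\<close> contributes a positive term on the left.\<close>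
  have above: "\<exists>k\<in>K. c0 \<le> a k"
  proof (rule ccontr)
    assume neg: "\<not> ?thesis"
    define x where "x = Max (a ` K)"
    have le: "a k \<le> x" if "k \<in> K" for k using that finK by (simp add: x_def)
    have "x \<in> a ` K" using finK Kne by (auto simp: x_def intro!: Max_in)
    then have "x < c0" using neg by force
    have "(\<Sum>k\<in>K. max 0 (a k - x)) = 0" by (intro sum.neutral ballI) (use le in force)
    moreover have "0 \<le> (\<Sum>i\<in>I. max 0 (c i - x))" by (intro sum_nonneg) simp
    ultimately show False using maj[of x] \<open>x < c0\<close> by simp
  qed
  \<comment> \<open>Otherwise no term on the right is truncated at the smallest eigenvalue
    \<open>x\<close>, and equal sums and cardinalities turn the right side into the untruncated left
    side. There the term \<open>c0 - x\<close> is negative, whereas \<open>maj\<close> counts it as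
    \<open>0\<close>.\<close>
  have below: "\<exists>k\<in>K. a k \<le> c0"
  proof (rule ccontr)
    assume neg: "\<not> ?thesis"
    define x where "x = Min (a ` K)"
    have le: "x \<le> a k" if "k \<in> K" for k using that finK by (simp add: x_def)
    have "x \<in> a ` K" using finK Kne by (auto simp: x_def intro!: Min_in)
    then have "c0 < x" using neg by force
    have "(\<Sum>k\<in>K. max 0 (a k - x)) = (\<Sum>k\<in>K. a k - x)"
      by (intro sum.cong refl) (use le in force)
    also have "\<dots> = c0 + sum c I - x * real (Suc (card I))"
      using tot cardK by (simp add: sum_subtractf algebra_simps)
    also have "\<dots> = c0 - x + (\<Sum>i\<in>I. c i - x)" by (simp add: sum_subtractf algebra_simps)
    also have "\<dots> \<le> c0 - x + (\<Sum>i\<in>I. max 0 (c i - x))" by (intro add_left_mono sum_mono) simp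
    finally show False using maj[of x] \<open>c0 < x\<close> by simp
  qed
  show ?case
  proof (cases "\<exists>k\<in>K. a k = c0")
    case True
    then obtain q where q: "q \<in> K" "a q = c0" by auto
    define K' where "K' = K - {q}"
    have K: "K = insert q K'" "q \<notin> K'" "finite K'" using q finK by (auto simp: K'_def)
    \<comment> \<open>The terms of \<open>c0\<close> and \<open>a q\<close> cancel in
      \<open>maj\<close>, so the induction hypothesis applies to the other eigenvalues.\<close>
    have "\<exists>u. (\<forall>k\<in>K'. \<forall>l\<in>K'. (\<Sum>i\<in>I. u k i * u l i) = (if k = l then 1 else 0)) \<and>
      (\<forall>i\<in>I. (\<Sum>k\<in>K'. a k * (u k i)\<^sup>2) = c i)"
    proof (rule insert.IH)
      show "(\<Sum>i\<in>I. max 0 (c i - x)) \<le> (\<Sum>k\<in>K'. max 0 (a k - x))" for x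
        using maj[of x] K q by simp
    qed (use cardK tot K q in auto)
    then obtain u where u: "\<And>k l. k \<in> K' \<Longrightarrow> l \<in> K' \<Longrightarrow> (\<Sum>i\<in>I. u k i * u l i) = (if k = l then 1 else 0)"
      and ud: "\<And>i. i \<in> I \<Longrightarrow> (\<Sum>k\<in>K'. a k * (u k i)\<^sup>2) = c i" by blast
    define v where "v k i = (if k = q then of_bool (i = i0) else if i = i0 then 0 else u k i)" for k i
    have vI: "i \<in> I \<Longrightarrow> v q i = 0" "k \<in> K' \<Longrightarrow> i \<in> I \<Longrightarrow> v k i = u k i" for k i
      using insert.hyps K by (auto simp: v_def)
    have v0: "v q i0 = 1" "k \<in> K' \<Longrightarrow> v k i0 = 0" for k
      using K by (auto simp: v_def)
    show ?thesis
    proof (intro exI[of _ v] conjI ballI)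
      fix k l assume "k \<in> K" "l \<in> K"
      then show "(\<Sum>i\<in>insert i0 I. v k i * v l i) = (if k = l then 1 else 0)"
        using u K insert.hyps by (auto simp: vI v0)
    next
      fix i assume "i \<in> insert i0 I"
      then show "(\<Sum>k\<in>K. a k * (v k i)\<^sup>2) = c i"
        using ud K q by (auto simp: vI v0 c0_def)
    qed
  next
    case False
    \<comment> \<open>The eigenvalues adjacent to \<open>c0\<close>: \<open>a p\<close> is the least
      one above it, \<open>a q\<close> the greatest one below.\<close>
    define p where "p = arg_min_on a {k \<in> K. c0 \<le> a k}"
    define q where "q = arg_min_on (\<lambda>k. - a k) {k \<in> K. a k \<le> c0}"
    have p: "p \<in> K" "c0 < a p" and p_min: "\<And>k. k \<in> K \<Longrightarrow> c0 \<le> a k \<Longrightarrow> a p \<le> a k"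
      using arg_min_if_finite(1)[of "{k \<in> K. c0 \<le> a k}" a] above False finK
        arg_min_least[of "{k \<in> K. c0 \<le> a k}" _ a]
      by (force simp: p_def)+
    have q: "q \<in> K" "a q < c0" and q_max: "\<And>k. k \<in> K \<Longrightarrow> a k \<le> c0 \<Longrightarrow> a k \<le> a q"
      using arg_min_if_finite(1)[of "{k \<in> K. a k \<le> c0}" "\<lambda>k. - a k"] below False finK
        arg_min_least[of "{k \<in> K. a k \<le> c0}" _ "\<lambda>k. - a k"]
      by (force simp: q_def)+
    define R where "R = K - {p, q}"
    \<comment> \<open>Fixed by the trace: a symmetric 2 by 2 matrix with eigenvalues
      \<open>a p\<close>, \<open>a q\<close> and one diagonal entry \<open>c0\<close> has
      \<open>b\<close> as its other entry. In the reduced problem index \<open>p\<close> carries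
      \<open>b\<close>.\<close>
    define b where "b = a p + a q - c0"
    have K: "K = insert p (insert q R)" "p \<notin> R" "q \<notin> R" "p \<noteq> q" "finite R"
      using p q finK by (auto simp: R_def)
    define a' where "a' = a(p := b)"
    have b: "a q < b" "b < a p" using p q by (auto simp: b_def)
    define S where "S = {k \<in> R. a p \<le> a k}"
    have R_cases: "a p \<le> a k \<or> a k \<le> a q" if "k \<in> R" for k
      using p_min[of k] q_max[of k] that by (fastforce simp: R_def)
    \<comment> \<open>Nothing in \<open>R\<close> lies strictly between \<open>a q\<close> and
      \<open>a p\<close>, so this sum is affine there with slope \<open>- card S\<close>.\<close>
    have Rsum: "(\<Sum>k\<in>R. max 0 (a k - x)) = (\<Sum>k\<in>S. a k - x)" if "a q \<le> x" "x \<le> a p" for x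
    proof -
      have "(\<Sum>k\<in>R. max 0 (a k - x)) = (\<Sum>k\<in>S. max 0 (a k - x))"
        using K R_cases that by (intro sum.mono_neutral_right) (force simp: S_def)+
      also have "\<dots> = (\<Sum>k\<in>S. a k - x)" using that by (intro sum.cong) (auto simp: S_def)
      finally show ?thesis .
    qed
    have maj': "max 0 (c0 - x) + (\<Sum>i\<in>I. max 0 (c i - x))
        \<le> max 0 (a p - x) + max 0 (a q - x) + (\<Sum>k\<in>R. max 0 (a k - x))" for x
      using maj[of x] K by simp
    have at_p: "(\<Sum>i\<in>I. max 0 (c i - a p)) \<le> (\<Sum>k\<in>S. a k - a p)"
      using maj'[of "a p"] Rsum[of "a p"] p q by simp
    have at_q: "c0 - a q + (\<Sum>i\<in>I. max 0 (c i - a q)) \<le> a p - a q + (\<Sum>k\<in>S. a k - a q)"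
      using maj'[of "a q"] Rsum[of "a q"] p q by simp
    \<comment> \<open>At the new kink \<open>b\<close> convexity is not enough: the slope of the left-hand side, an integer,
      has to be compared with the slope \<open>- card S\<close> of the right-hand side.\<close>
    have at_b: "(\<Sum>i\<in>I. max 0 (c i - b)) \<le> (\<Sum>k\<in>S. a k - b)"
    proof -
      define T where "T = {i \<in> I. b < c i}"
      have finT: "finite T" "T \<subseteq> I" using insert.hyps by (auto simp: T_def)
      have T: "(\<Sum>i\<in>I. max 0 (c i - b)) = (\<Sum>i\<in>T. c i - b)"
      proof -
        have "(\<Sum>i\<in>I. max 0 (c i - b)) = (\<Sum>i\<in>T. max 0 (c i - b))"
          using insert.hyps by (intro sum.mono_neutral_right) (force simp: T_def)+
        also have "\<dots> = (\<Sum>i\<in>T. c i - b)" by (intro sum.cong) (auto simp: T_def)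
        finally show ?thesis .
      qed
      \<comment> \<open>\<open>T\<close> is selected at \<open>b\<close>, but its sum is a
        supporting line that bounds the convex left side from below at every \<open>x\<close>. It is
        compared at \<open>a p\<close> if \<open>card T \<le> card S\<close>, and at
        \<open>a q\<close> if \<open>card T \<ge> card S + 1\<close>.\<close>
      have T_le: "(\<Sum>i\<in>T. c i - x) \<le> (\<Sum>i\<in>I. max 0 (c i - x))" for x
      proof -
        have "(\<Sum>i\<in>T. c i - x) \<le> (\<Sum>i\<in>T. max 0 (c i - x))" by (intro sum_mono) simp
        also have "\<dots> \<le> (\<Sum>i\<in>I. max 0 (c i - x))"
          using finT insert.hyps by (intro sum_mono2) auto
        finally show ?thesis .
      qed
      show ?thesis
      proof (cases "card T \<le> card S")
        case True
        then have "real (card T) * (a p - b) \<le> real (card S) * (a p - b)"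
          using b by (intro mult_right_mono) auto
        then show ?thesis using T T_le[of "a p"] at_p
          by (simp add: sum_subtractf algebra_simps)
      next
        case False
        then have "(1 + real (card S)) * (b - a q) \<le> real (card T) * (b - a q)"
          using b by (intro mult_right_mono) auto
        moreover have "c0 = a p + a q - b" by (simp add: b_def)
        ultimately show ?thesis using T T_le[of "a q"] at_q
          unfolding sum_subtractf sum_constant ring_distribs by linarith
      qed
    qed
    have maj_new: "(\<Sum>i\<in>I. max 0 (c i - x)) \<le> max 0 (b - x) + (\<Sum>k\<in>R. max 0 (a k - x))" for x
    proof -
      have insR: "(\<Sum>k\<in>insert p R. max 0 (a' k - x)) = max 0 (b - x) + (\<Sum>k\<in>R. max 0 (a k - x))" for x
      proof -
        have "(\<Sum>k\<in>R. max 0 (a' k - x)) = (\<Sum>k\<in>R. max 0 (a k - x))"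
          using K by (intro sum.cong) (auto simp: a'_def)
        then show ?thesis using K by (simp add: a'_def)
      qed
      have gap: "a' k \<le> a q \<or> b \<le> a' k" "a' k \<le> b \<or> a p \<le> a' k" if "k \<in> insert p R" for k
        using that R_cases[of k] b by (auto simp: a'_def)
      \<comment> \<open>Outside the open interval from \<open>a q\<close> to \<open>a p\<close>, the
        positive parts of \<open>a p\<close>, \<open>a q\<close>, \<open>c0\<close> and
        \<open>b\<close> are all linear or all zero, so \<open>a p + a q = c0 + b\<close> carries
        \<open>maj'\<close> over. On the two inner intervals convexity reduces the claim to
        \<open>a q\<close>, \<open>b\<close> and \<open>a p\<close>.\<close>
      consider "x \<le> a q" | "a p \<le> x" | "a q \<le> x" "x \<le> b" | "b \<le> x" "x \<le> a p" by linarith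
      then show ?thesis
      proof cases
        case 1
        then show ?thesis using maj'[of x] p q b by (simp add: b_def)
      next
        case 2
        then show ?thesis using maj'[of x] p q b by simp
      next
        case 3
        have "(\<Sum>i\<in>I. max 0 (c i - x)) \<le> (\<Sum>k\<in>insert p R. max 0 (a' k - x))"
        proof (rule pos_part_sum_le_between[OF 3 gap(1)])
          show "(\<Sum>i\<in>I. max 0 (c i - a q)) \<le> (\<Sum>k\<in>insert p R. max 0 (a' k - a q))"
            unfolding insR using at_q b Rsum[of "a q"] by (simp add: b_def)
          show "(\<Sum>i\<in>I. max 0 (c i - b)) \<le> (\<Sum>k\<in>insert p R. max 0 (a' k - b))"
            unfolding insR using at_b b Rsum[of b] by simp
        qed
        then show ?thesis by (simp only: insR)
      next
        case 4
        have "(\<Sum>i\<in>I. max 0 (c i - x)) \<le> (\<Sum>k\<in>insert p R. max 0 (a' k - x))"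
        proof (rule pos_part_sum_le_between[OF 4 gap(2)])
          show "(\<Sum>i\<in>I. max 0 (c i - a p)) \<le> (\<Sum>k\<in>insert p R. max 0 (a' k - a p))"
            unfolding insR using at_p b Rsum[of "a p"] by simp
          show "(\<Sum>i\<in>I. max 0 (c i - b)) \<le> (\<Sum>k\<in>insert p R. max 0 (a' k - b))"
            unfolding insR using at_b b Rsum[of b] by simp
        qed
        then show ?thesis by (simp only: insR)
      qed
    qed
    have "\<exists>u. (\<forall>k\<in>insert p R. \<forall>l\<in>insert p R. (\<Sum>i\<in>I. u k i * u l i) = (if k = l then 1 else 0)) \<and>
      (\<forall>i\<in>I. (\<Sum>k\<in>insert p R. a' k * (u k i)\<^sup>2) = c i)"
    proof (rule insert.IH)
      have a'R: "sum a' R = sum a R" "(\<Sum>k\<in>R. max 0 (a' k - x)) = (\<Sum>k\<in>R. max 0 (a k - x))" for x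
        using K by (auto simp: a'_def intro!: sum.cong)
      show "card I = card (insert p R)" using cardK K by simp
      show "sum c I = sum a' (insert p R)" using tot K a'R by (simp add: a'_def b_def)
      show "(\<Sum>i\<in>I. max 0 (c i - x)) \<le> (\<Sum>k\<in>insert p R. max 0 (a' k - x))" for x
        using maj_new[of x] K a'R by (simp add: a'_def)
    qed (use K in auto)
    then obtain u where u: "\<And>k l. k \<in> insert p R \<Longrightarrow> l \<in> insert p R \<Longrightarrow>
        (\<Sum>i\<in>I. u k i * u l i) = (if k = l then 1 else 0)"
      and ud': "\<And>i. i \<in> I \<Longrightarrow> (\<Sum>k\<in>insert p R. a' k * (u k i)\<^sup>2) = c i" by blast
    have ud: "b * (u p i)\<^sup>2 + (\<Sum>k\<in>R. a k * (u k i)\<^sup>2) = c i" if "i \<in> I" for i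
    proof -
      have "(\<Sum>k\<in>R. a' k * (u k i)\<^sup>2) = (\<Sum>k\<in>R. a k * (u k i)\<^sup>2)"
        using K by (intro sum.cong) (auto simp: a'_def)
      then show ?thesis using ud'[OF that] K by (simp add: a'_def)
    qed
    \<comment> \<open>Cosine and sine of the rotation, determined by
      \<open>a p * s\<^sup>2 + a q * t\<^sup>2 = c0\<close>; they are real because \<open>c0\<close>
      lies between the two eigenvalues.\<close>
    define s where "s = sqrt ((c0 - a q) / (a p - a q))"
    define t where "t = sqrt ((a p - c0) / (a p - a q))"
    have s2: "s\<^sup>2 = (c0 - a q) / (a p - a q)" and t2: "t\<^sup>2 = (a p - c0) / (a p - a q)"
      using p q by (auto simp: s_def t_def)
    have st: "s\<^sup>2 + t\<^sup>2 = 1" "a p * s\<^sup>2 + a q * t\<^sup>2 = c0" "a p * t\<^sup>2 + a q * s\<^sup>2 = b"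
      using p q by (simp_all add: s2 t2 b_def divide_simps) (simp_all add: algebra_simps)
    \<comment> \<open>Rows \<open>p\<close> and \<open>q\<close> are the rotated pair formed from
      the unit vector at \<open>i0\<close> and the old row \<open>p\<close>. At \<open>i0\<close>
      their weighted squares add up to \<open>c0\<close>; on \<open>I\<close> they recombine to the
      old contribution \<open>b * (u p i)\<^sup>2\<close>.\<close>
    define v where "v k i = (if k = p then (if i = i0 then s else t * u p i)
      else if k = q then (if i = i0 then t else - s * u p i)
      else if i = i0 then 0 else u k i)" for k i
    have vI: "i \<in> I \<Longrightarrow> v p i = t * u p i" "i \<in> I \<Longrightarrow> v q i = - s * u p i"
      "k \<in> R \<Longrightarrow> i \<in> I \<Longrightarrow> v k i = u k i" for k i
      using insert.hyps K by (auto simp: v_def)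
    have v0: "v p i0 = s" "v q i0 = t" "k \<in> R \<Longrightarrow> v k i0 = 0" for k
      using K by (auto simp: v_def)
    have pp: "(\<Sum>i\<in>I. u p i * u p i) = 1" using u[of p p] by simp
    have pk: "(\<Sum>i\<in>I. u p i * u k i) = 0" if "k \<in> R" for k using u[of p k] that K by auto
    have sp: "v p i0 * v p i0 + (\<Sum>i\<in>I. v p i * v p i) = 1"
      "v q i0 * v q i0 + (\<Sum>i\<in>I. v q i * v q i) = 1"
      "v p i0 * v q i0 + (\<Sum>i\<in>I. v p i * v q i) = 0"
      "k \<in> R \<Longrightarrow> v p i0 * v k i0 + (\<Sum>i\<in>I. v p i * v k i) = 0"
      "k \<in> R \<Longrightarrow> v q i0 * v k i0 + (\<Sum>i\<in>I. v q i * v k i) = 0" 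
      "k \<in> R \<Longrightarrow> l \<in> R \<Longrightarrow> v k i0 * v l i0 + (\<Sum>i\<in>I. v k i * v l i) = (if k = l then 1 else 0)" for k l
    proof -
      have "(\<Sum>i\<in>I. v p i * v p i) = t\<^sup>2 * (\<Sum>i\<in>I. u p i * u p i)"
        "(\<Sum>i\<in>I. v q i * v q i) = s\<^sup>2 * (\<Sum>i\<in>I. u p i * u p i)"
        "(\<Sum>i\<in>I. v p i * v q i) = - s * t * (\<Sum>i\<in>I. u p i * u p i)"
        by (simp_all add: vI sum_distrib_left power2_eq_square algebra_simps)
      then show "v p i0 * v p i0 + (\<Sum>i\<in>I. v p i * v p i) = 1"
        "v q i0 * v q i0 + (\<Sum>i\<in>I. v q i * v q i) = 1"
        "v p i0 * v q i0 + (\<Sum>i\<in>I. v p i * v q i) = 0"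
        using st by (simp_all add: pp v0 power2_eq_square algebra_simps)
      show "k \<in> R \<Longrightarrow> l \<in> R \<Longrightarrow> v k i0 * v l i0 + (\<Sum>i\<in>I. v k i * v l i) = (if k = l then 1 else 0)"
        using u[of k l] by (simp add: v0 vI)
      assume k: "k \<in> R"
      have "(\<Sum>i\<in>I. v p i * v k i) = t * (\<Sum>i\<in>I. u p i * u k i)"
        "(\<Sum>i\<in>I. v q i * v k i) = - s * (\<Sum>i\<in>I. u p i * u k i)"
        using k by (simp_all add: vI sum_distrib_left sum_negf algebra_simps)
      then show "v p i0 * v k i0 + (\<Sum>i\<in>I. v p i * v k i) = 0"
        "v q i0 * v k i0 + (\<Sum>i\<in>I. v q i * v k i) = 0" 
        using k by (simp_all add: v0 pk)
    qed
    define G where "G k l = v k i0 * v l i0 + (\<Sum>i\<in>I. v k i * v l i)" for k l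
    have G: "G p p = 1" "G q q = 1" "G p q = 0" "k \<in> R \<Longrightarrow> G p k = 0" "k \<in> R \<Longrightarrow> G q k = 0"
      "k \<in> R \<Longrightarrow> l \<in> R \<Longrightarrow> G k l = (if k = l then 1 else 0)" for k l
      unfolding G_def by (fact sp)+
    have G_comm: "G k l = G l k" for k l by (simp add: G_def mult.commute)
    show ?thesis
    proof (intro exI[of _ v] conjI ballI)
      fix k l assume "k \<in> K" "l \<in> K"
      then have "k = p \<or> k = q \<or> k \<in> R" "l = p \<or> l = q \<or> l \<in> R" using K by auto
      then have "G k l = (if k = l then 1 else 0)"
        using G G_comm[of q p] G_comm[of k p] G_comm[of k q] K by (elim disjE) auto
      then show "(\<Sum>i\<in>insert i0 I. v k i * v l i) = (if k = l then 1 else 0)"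
        using insert.hyps by (simp add: G_def)
    next
      fix i assume "i \<in> insert i0 I"
      moreover have "(\<Sum>k\<in>K. a k * (v k i)\<^sup>2)
          = a p * (v p i)\<^sup>2 + a q * (v q i)\<^sup>2 + (\<Sum>k\<in>R. a k * (v k i)\<^sup>2)"
        using K by simp
      moreover have "a p * (t * x)\<^sup>2 + a q * (s * x)\<^sup>2 = b * x\<^sup>2" for x
        unfolding st(3)[symmetric] by (simp add: power_mult_distrib algebra_simps)
      ultimately show "(\<Sum>k\<in>K. a k * (v k i)\<^sup>2) = c i"
        using ud[of i] st(2) by (auto simp: vI v0 c0_def)
    qed
  qed
qed

subsection \<open>Collapsing the tails of an infinite diagonal\<close>

text \<open>The map \<open>g\<close> keeps the head and merges the tail into finitely many classes,
  each represented by its sum. At \<open>y = 0\<close> merging can only lower the total, as the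
  positive part is subadditive. At \<open>y \<ge> \<epsilon>\<close> the merged classes contribute
  nothing, their sums being at most the tail sum, and the head is unchanged.\<close>

lemma sum_pos_part_collapse_le:
  fixes d :: "nat \<Rightarrow> real"
  assumes g: "\<And>i. i < M \<Longrightarrow> g i = i" "\<And>i. M \<le> i \<Longrightarrow> M \<le> g i" "finite (range g)"
    and d: "summable (\<lambda>i. \<bar>d i\<bar>)" and tail: "(\<Sum>i. \<bar>d (i + M)\<bar>) \<le> \<epsilon>"
    and y: "y = 0 \<or> \<epsilon> \<le> y"
    and bound: "\<And>n. (\<Sum>i<n. max 0 (d i - y)) \<le> B"
  shows "(\<Sum>l\<in>range g. max 0 ((\<Sum>i. if g i = l then d i else 0) - y)) \<le> B"
proof -
  define c where "c l = (\<Sum>i. if g i = l then d i else 0)" for l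
  have summ: "summable (\<lambda>i. if g i = l then d i else 0)" for l
    by (rule summable_comparison_test[OF _ d]) auto
  have lt_M: "{..<M} \<subseteq> range g" using g(1) by (metis image_eqI UNIV_I lessThan_iff subsetI)
  have c_lt: "c l = d l" if "l < M" for l
  proof -
    have "(if g i = l then d i else 0) = (if i = l then d i else 0)" for i
      using g(1)[of i] g(1)[of l] g(2)[of i] that by (cases "i < M") auto
    then show ?thesis using sums_single[of l d] by (simp add: c_def sums_iff)
  qed
  have "(\<Sum>l\<in>range g. max 0 (c l - y)) \<le> B" using y
  proof
    assume "y = 0"
    define f where "f = (\<lambda>l i. if g i = l then max 0 (d i) else 0)"
    have summ_f: "summable (f l)" for l
      by (rule summable_comparison_test[OF _ d]) (auto simp: f_def)
    have "(\<Sum>l\<in>range g. max 0 (c l)) \<le> (\<Sum>l\<in>range g. \<Sum>i. f l i)"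
      unfolding c_def
      by (intro sum_mono max.boundedI suminf_nonneg suminf_le summ summ_f) (auto simp: f_def)
    also have "\<dots> = (\<Sum>i. \<Sum>l\<in>range g. f l i)" by (rule suminf_sum[symmetric]) (rule summ_f)
    also have "\<dots> = (\<Sum>i. max 0 (d i))" using g(3) by (simp add: f_def)
    also have "\<dots> \<le> B"
      using bound \<open>y = 0\<close> by (intro suminf_le_const summable_comparison_test[OF _ d]) auto
    finally show ?thesis using \<open>y = 0\<close> by simp
  next
    assume y: "\<epsilon> \<le> y"
    have "c l \<le> \<epsilon>" if "M \<le> l" for l
    proof -
      define f where "f i = (if g i = l then d i else 0)" for i
      have "c l = (\<Sum>i. f (i + M)) + (\<Sum>i<M. f i)"
        unfolding c_def f_def using summ by (rule suminf_split_initial_segment)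
      also have "(\<Sum>i<M. f i) = 0" using g(1) that by (intro sum.neutral) (auto simp: f_def)
      also have "(\<Sum>i. f (i + M)) \<le> (\<Sum>i. \<bar>d (i + M)\<bar>)"
        using summable_ignore_initial_segment[OF summ[of l], of M]
          summable_ignore_initial_segment[OF d, of M]
        by (intro suminf_le) (auto simp: f_def)
      finally show ?thesis using tail by simp
    qed
    then have "c l - y \<le> 0" if "M \<le> l" for l using y that by fastforce
    then have "max 0 (c l - y) = 0" if "\<not> l < M" for l using that by (simp add: max_absorb1)
    then have "(\<Sum>l\<in>range g. max 0 (c l - y)) = (\<Sum>l<M. max 0 (c l - y))"
      using lt_M g(3) by (intro sum.mono_neutral_right) auto
    also have "\<dots> = (\<Sum>l<M. max 0 (d l - y))" by (simp add: c_lt)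
    finally show ?thesis using bound[of M] by simp
  qed
  then show ?thesis by (simp add: c_def)
qed

text \<open>The rows \<open>U k\<close> are orthonormal square-summable sequences. The collapsed
  finite problem is solved first, and its solution is then spread over the classes of
  \<open>g\<close> by unit weight vectors.\<close>

lemma schur_horn_sequence:
  fixes d :: "nat \<Rightarrow> real" and a :: "'k \<Rightarrow> real" and X :: "real set"
  assumes finK: "finite K" and X: "finite X" "0 \<in> X" "\<And>k. k \<in> K \<Longrightarrow> a k \<in> X"
    and pos: "\<And>x n. x \<in> X \<Longrightarrow> 0 \<le> x \<Longrightarrow>
      (\<Sum>i<n. max 0 (d i - x)) \<le> (\<Sum>k\<in>K. max 0 (a k - x))"
    and neg: "\<And>x n. x \<in> X \<Longrightarrow> x \<le> 0 \<Longrightarrow>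
      (\<Sum>i<n. max 0 (x - d i)) \<le> (\<Sum>k\<in>K. max 0 (x - a k))"
    and trace: "d sums sum a K"
  shows "\<exists>U. (\<forall>k\<in>K. \<forall>l\<in>K. (\<lambda>i. U k i * U l i) sums (if k = l then 1 else 0)) \<and>
    (\<forall>i. (\<Sum>k\<in>K. a k * (U k i)\<^sup>2) = d i)"
proof -
  \<comment> \<open>At \<open>x = 0\<close>, which belongs to \<open>X\<close>, the hypotheses bound
    the positive and the negative parts.\<close>
  have abs_d: "summable (\<lambda>i. \<bar>d i\<bar>)"
  proof (rule summableI_nonneg_bounded)
    show "(\<Sum>i<n. \<bar>d i\<bar>) \<le> (\<Sum>k\<in>K. max 0 (a k - 0)) + (\<Sum>k\<in>K. max 0 (0 - a k))" for n
    proof -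
      have "(\<Sum>i<n. \<bar>d i\<bar>) = (\<Sum>i<n. max 0 (d i - 0)) + (\<Sum>i<n. max 0 (0 - d i))"
        unfolding sum.distrib[symmetric] by (intro sum.cong) auto
      also have "\<dots> \<le> (\<Sum>k\<in>K. max 0 (a k - 0)) + (\<Sum>k\<in>K. max 0 (0 - a k))"
        using X by (intro add_mono pos neg) auto
      finally show ?thesis .
    qed
  qed simp
  \<comment> \<open>The distance from \<open>0\<close> to the rest of \<open>X\<close>, capped by
    \<open>1\<close> to keep the set nonempty. Every element of \<open>X\<close> is then
    \<open>0\<close> or at least \<open>\<epsilon>\<close> in absolute value, as the collapsing
    lemma requires.\<close>
  define \<epsilon> where "\<epsilon> = Min (insert 1 (abs ` (X - {0})))"
  have "\<epsilon> \<in> insert 1 (abs ` (X - {0}))" unfolding \<epsilon>_def using X by (intro Min_in) auto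
  then have "0 < \<epsilon>" by auto
  have \<epsilon>: "x = 0 \<or> \<epsilon> \<le> \<bar>x\<bar>" if "x \<in> X" for x using that X by (auto simp: \<epsilon>_def intro!: Min_le)
  obtain M0 where M0: "\<And>n. n \<ge> M0 \<Longrightarrow> norm (\<Sum>i. \<bar>d (i + n)\<bar>) < \<epsilon>"
    using suminf_exist_split[OF \<open>0 < \<epsilon>\<close> abs_d] by auto
  \<comment> \<open>Past \<open>M0\<close> the tail is small; \<open>card K\<close> leaves room for
    all eigenvalues in the finite problem.\<close>
  define M where "M = max M0 (card K)"
  have tail: "(\<Sum>i. \<bar>d (i + M)\<bar>) \<le> \<epsilon>" using M0[of M] by (simp add: M_def)
  \<comment> \<open>Nonnegative tail entries go to class \<open>M\<close>, negative ones to
    \<open>Suc M\<close>, so that no class mixes signs. Either class may be empty, which is why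
    \<open>I\<close> is the range of \<open>g\<close>.\<close>
  define g where "g i = (if i < M then i else if 0 \<le> d i then M else Suc M)" for i
  define c where "c l = (\<Sum>i. if g i = l then d i else 0)" for l
  define I where "I = range g"
  have "I \<subseteq> {..Suc M}" by (auto simp: I_def g_def)
  then have finI: "finite I" by (rule finite_subset) simp
  have "{..<M} \<subseteq> I" by (auto simp: I_def g_def image_iff)
  then have "M \<le> card I" using card_mono[OF finI, of "{..<M}"] by simp
  then have card_le: "card K \<le> card I" by (simp add: M_def)
  have g: "\<And>i. i < M \<Longrightarrow> g i = i" "\<And>i. M \<le> i \<Longrightarrow> M \<le> g i" "finite (range g)"
    using finI by (auto simp: g_def I_def)
  have summ_c: "(\<lambda>i. if g i = l then d i else 0) sums c l" for l
    unfolding c_def by (intro summable_sums summable_comparison_test[OF _ abs_d]) auto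

  have sum_c: "sum c I = sum a K"
  proof -
    have "(\<lambda>i. \<Sum>l\<in>I. if g i = l then d i else 0) sums sum c I" by (intro sums_sum summ_c)
    moreover have "(\<Sum>l\<in>I. if g i = l then d i else 0) = d i" for i
      using finI by (simp add: I_def)
    ultimately show ?thesis using trace sums_unique2 by simp
  qed
  have c_pos: "(\<Sum>l\<in>I. max 0 (c l - x)) \<le> (\<Sum>k\<in>K. max 0 (a k - x))" if "0 \<le> x" for x
  proof (rule pos_part_sum_le_if_le_at_kinks[OF X _ that])
    show "(\<Sum>l\<in>I. max 0 (c l - y)) \<le> (\<Sum>k\<in>K. max 0 (a k - y))" if "y \<in> X" "0 \<le> y" for y
      unfolding c_def I_def using \<epsilon>[of y] that
      by (intro sum_pos_part_collapse_le[OF g abs_d tail] pos) auto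
  qed
  have c_neg: "(\<Sum>l\<in>I. max 0 (- c l - x)) \<le> (\<Sum>k\<in>K. max 0 (- a k - x))" if "0 \<le> x" for x
  proof (rule pos_part_sum_le_if_le_at_kinks[OF _ _ _ _ that])
    show "(\<Sum>l\<in>I. max 0 (- c l - y)) \<le> (\<Sum>k\<in>K. max 0 (- a k - y))"
      if "y \<in> uminus ` X" "0 \<le> y" for y
    proof -
      have "- y \<in> X" using that by auto
      have "(\<Sum>l\<in>range g. max 0 ((\<Sum>i. if g i = l then - d i else 0) - y))
          \<le> (\<Sum>k\<in>K. max 0 (- a k - y))"
      proof (rule sum_pos_part_collapse_le[OF g])
        show "(\<Sum>i<n. max 0 (- d i - y)) \<le> (\<Sum>k\<in>K. max 0 (- a k - y))" for n
          using neg[OF \<open>- y \<in> X\<close>, of n] that by (simp add: minus_diff_commute)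
      qed (use \<epsilon>[OF \<open>- y \<in> X\<close>] that abs_d tail in auto)
      moreover have "(\<Sum>i. if g i = l then - d i else 0) = - c l" for l
        using sums_minus[OF summ_c[of l]] by (auto simp: sums_iff if_distrib cong: if_cong)
      ultimately show ?thesis by (simp add: I_def)
    qed
  qed (use X in auto)

  \<comment> \<open>The finite theorem wants as many eigenvalues as diagonal entries, so zeros are
    added under the \<open>Inr\<close> indices.\<close>
  define K' where "K' = Inl ` K \<union> Inr ` {..<card I - card K}"
  define a' where "a' = case_sum a (\<lambda>_ :: nat. 0)"
  have finK': "finite K'" using finK by (simp add: K'_def)
  have sum_K': "(\<Sum>k\<in>K'. h k) = (\<Sum>k\<in>K. h (Inl k)) + (\<Sum>j<card I - card K. h (Inr j))"
    for h :: "'k + nat \<Rightarrow> real"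
    unfolding K'_def using finK by (subst sum.union_disjoint) (auto simp: sum.reindex)
  have cardK': "card I = card K'"
    using card_le finK unfolding K'_def
    by (subst card_Un_disjoint) (auto simp: card_image)
  have "\<exists>u. (\<forall>k\<in>K'. \<forall>l\<in>K'. (\<Sum>i\<in>I. u k i * u l i) = (if k = l then 1 else 0)) \<and>
    (\<forall>i\<in>I. (\<Sum>k\<in>K'. a' k * (u k i)\<^sup>2) = c i)"
  proof (rule schur_horn_finite[OF finI finK' cardK'])
    show sums: "sum c I = sum a' K'" by (simp add: sum_c sum_K' a'_def)
    show "(\<Sum>i\<in>I. max 0 (c i - x)) \<le> (\<Sum>k\<in>K'. max 0 (a' k - x))" for x
    proof (cases "0 \<le> x")
      case True
      then show ?thesis using c_pos[OF True] by (simp add: sum_K' a'_def)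
    next
      case False
      have neg_K': "(\<Sum>k\<in>K'. max 0 (x - a' k)) = (\<Sum>k\<in>K. max 0 (x - a k))"
        using False by (simp add: sum_K' a'_def)
      \<comment> \<open>A positive part is a linear term plus a negative part. The linear terms
        agree by trace and cardinality, the negative parts are handled by \<open>c_neg\<close>, and
        the added zeros contribute nothing there as \<open>x < 0\<close>.\<close>
      have pm: "max 0 (s - x) = (s - x) + max 0 (- s - (- x))" for s by auto
      have "(\<Sum>i\<in>I. max 0 (c i - x)) = (\<Sum>i\<in>I. c i - x) + (\<Sum>i\<in>I. max 0 (- c i - (- x)))"
        unfolding sum.distrib[symmetric] by (intro sum.cong refl pm)
      also have "\<dots> \<le> (\<Sum>k\<in>K'. a' k - x) + (\<Sum>k\<in>K'. max 0 (- a' k - (- x)))"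
        using c_neg[of "- x"] False sums cardK' neg_K' by (simp add: sum_subtractf)
      also have "\<dots> = (\<Sum>k\<in>K'. max 0 (a' k - x))"
        unfolding sum.distrib[symmetric] by (intro sum.cong refl pm[symmetric])
      finally show ?thesis .
    qed
  qed
  then obtain u where u: "\<And>k l. k \<in> K' \<Longrightarrow> l \<in> K' \<Longrightarrow> (\<Sum>i\<in>I. u k i * u l i) = (if k = l then 1 else 0)"
    and ud: "\<And>i. i \<in> I \<Longrightarrow> (\<Sum>k\<in>K'. a' k * (u k i)\<^sup>2) = c i" by blast

  \<comment> \<open>All entries of a class share one sign \<open>s\<close>, so the class sum
    dominates each of them in absolute value. Hence \<open>d i / c (g i)\<close> is never negative,
    and a class with sum \<open>0\<close> consists of zeros.\<close>
  have same_sign: "0 \<le> d i * c (g i)" and zero: "c (g i) = 0 \<Longrightarrow> d i = 0" for i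
  proof -
    define f where "f = (\<lambda>(s :: real) j. if g j = g i then s * d j else 0)"
    have f: "f s sums (s * c (g i))" for s
      using sums_mult[OF summ_c[of "g i"], of s] by (simp add: f_def if_distrib cong: if_cong)
    have "\<exists>s\<in>{1, -1}. \<forall>j. 0 \<le> f s j"
    proof -
      have "\<forall>j. g j = g i \<longrightarrow> 0 \<le> d i * d j"
        by (auto simp: g_def mult_nonpos_nonpos split: if_splits)
      then show ?thesis
        by (cases "0 < d i"; cases "d i = 0")
          (auto simp: f_def zero_le_mult_iff g_def split: if_splits)
    qed
    then obtain s where s: "s = 1 \<or> s = -1" "\<And>j. 0 \<le> f s j" by auto
    have "f s i \<le> s * c (g i)"
      using sum_le_suminf[of "f s" "{i}"] f[of s] s(2) by (auto simp: sums_iff)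
    moreover have "0 \<le> f s i" by (rule s)
    moreover have "f s i = s * d i" by (simp add: f_def)
    ultimately have *: "0 \<le> s * d i" "s * d i \<le> s * c (g i)" by auto
    show "0 \<le> d i * c (g i)" using s(1) * by (auto simp: zero_le_mult_iff)
    show "c (g i) = 0 \<Longrightarrow> d i = 0" using s(1) * by auto
  qed
  \<comment> \<open>Squared weights are the shares of the entries in their class sum. In a class
    with sum \<open>0\<close> any unit vector serves; the indicator of its least index is
    taken.\<close>
  define w where "w i = (if c (g i) = 0 then of_bool (i = (LEAST j. g j = g i))
    else sqrt (d i / c (g i)))" for i
  have w_sq: "(w i)\<^sup>2 = (if c (g i) = 0 then of_bool (i = (LEAST j. g j = g i)) else d i / c (g i))" for i
    using same_sign[of i] by (auto simp: w_def zero_le_divide_iff zero_le_mult_iff)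
  have w_c: "(w i)\<^sup>2 * c (g i) = d i" for i using zero[of i] by (simp add: w_sq)
  have w_sums: "(\<lambda>i. if g i = l then (w i)\<^sup>2 else 0) sums 1" if "l \<in> I" for l
  proof (cases "c l = 0")
    case True
    define i0 where "i0 = (LEAST j. g j = l)"
    have "g i0 = l" using that unfolding I_def i0_def by (metis (mono_tags) LeastI rangeE)
    then have "(if g i = l then (w i)\<^sup>2 else 0) = (if i = i0 then 1 else 0)" for i
      using True by (auto simp: w_sq i0_def)
    then show ?thesis using sums_single[of i0 "\<lambda>_. 1 :: real"] by simp
  next
    case False
    have "(if g i = l then (w i)\<^sup>2 else 0) = (if g i = l then d i else 0) / c l" for i
      using False by (simp add: w_sq)
    then show ?thesis using sums_divide[OF summ_c[of l], of "c l"] False by simp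
  qed
  \<comment> \<open>Composition of \<open>u\<close> with the isometry that sends the unit vector at
    \<open>l\<close> to the weights on the class of \<open>l\<close>. It multiplies diagonal entries
    by \<open>(w i)\<^sup>2\<close>, turning \<open>c (g i)\<close> into \<open>d i\<close>.\<close>
  show ?thesis
  proof (intro exI[of _ "\<lambda>k i. u (Inl k) (g i) * w i"] conjI ballI allI)
    fix k l assume kl: "k \<in> K" "l \<in> K"
    have "(\<lambda>i. \<Sum>j\<in>I. u (Inl k) j * u (Inl l) j * (if g i = j then (w i)\<^sup>2 else 0))
        sums (\<Sum>j\<in>I. u (Inl k) j * u (Inl l) j * 1)"
      by (intro sums_sum sums_mult w_sums)
    moreover have "(\<Sum>j\<in>I. u (Inl k) j * u (Inl l) j * (if g i = j then (w i)\<^sup>2 else 0))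
        = u (Inl k) (g i) * w i * (u (Inl l) (g i) * w i)" for i
      using finI by (simp add: I_def if_distrib[of "(*) _"] power2_eq_square cong: if_cong)
    ultimately show "(\<lambda>i. u (Inl k) (g i) * w i * (u (Inl l) (g i) * w i)) sums (if k = l then 1 else 0)"
      using u[of "Inl k" "Inl l"] kl by (simp add: K'_def)
  next
    fix i
    have "(\<Sum>k\<in>K. a k * (u (Inl k) (g i) * w i)\<^sup>2) = (\<Sum>k\<in>K'. a' k * (u k (g i))\<^sup>2) * (w i)\<^sup>2"
      by (simp add: sum_K' a'_def sum_distrib_right power_mult_distrib mult.assoc)
    also have "\<dots> = d i" using ud[of "g i"] w_c[of i] by (simp add: I_def mult.commute)
    finally show "(\<Sum>k\<in>K. a k * (u (Inl k) (g i) * w i)\<^sup>2) = d i" .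
  qed
qed

subsection \<open>Orthonormal systems\<close>

lemma cinner_0_left [simp]: "cinner 0 (y :: 'a::complex_hilbert_space) = 0"
  using cinner_add_left[of 0 0 y] by simp

lemma cinner_0_right [simp]: "cinner (x :: 'a::complex_hilbert_space) 0 = 0"
  using cinner_commute[of x 0] by simp

lemma cinner_add_right: "cinner (x :: 'a::complex_hilbert_space) (y + z) = cinner x y + cinner x z"
  by (metis cinner_commute cinner_add_left complex_cnj_add)

lemma cinner_scaleC_right: "cinner (x :: 'a::complex_hilbert_space) (c *\<^sub>C y) = cnj c * cinner x y"
  by (metis cinner_commute cinner_scaleC_left complex_cnj_mult)

lemma cinner_minus_left: "cinner (- x) (y :: 'a::complex_hilbert_space) = - cinner x y"
  using cinner_add_left[of x "- x" y] by (simp add: eq_neg_iff_add_eq_0 add.commute)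

lemma cinner_minus_right: "cinner (x :: 'a::complex_hilbert_space) (- y) = - cinner x y"
  using cinner_add_right[of x y "- y"] by (simp add: eq_neg_iff_add_eq_0 add.commute)

lemma cinner_diff_left: "cinner (x - y) (z :: 'a::complex_hilbert_space) = cinner x z - cinner y z"
  using cinner_add_left[of x "- y" z] by (simp add: cinner_minus_left)

lemma cinner_diff_right: "cinner (x :: 'a::complex_hilbert_space) (y - z) = cinner x y - cinner x z"
  using cinner_add_right[of x y "- z"] by (simp add: cinner_minus_right)

lemma cinner_sum_left: "cinner (sum f I) (y :: 'a::complex_hilbert_space) = (\<Sum>i\<in>I. cinner (f i) y)"
  by (induction I rule: infinite_finite_induct) (simp_all add: cinner_add_left)

lemma cinner_sum_right: "cinner (x :: 'a::complex_hilbert_space) (sum f I) = (\<Sum>i\<in>I. cinner x (f i))"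
  by (induction I rule: infinite_finite_induct) (simp_all add: cinner_add_right)

lemma cinner_self: "cinner x x = complex_of_real ((norm (x :: 'a::complex_hilbert_space))\<^sup>2)"
proof -
  have "Im (cinner x x) = 0" using cinner_commute[of x x] by (simp add: complex_eq_iff)
  \<comment> \<open>\<open>sqrt\<close> is increasing and odd, so a nonnegative norm forces a
    nonnegative radicand.\<close>
  moreover have "0 \<le> Re (cinner x x)"
    using norm_eq_sqrt_cinner[of x] norm_ge_zero[of x] by (metis real_sqrt_ge_0_iff)
  then have "(norm x)\<^sup>2 = Re (cinner x x)" by (simp add: norm_eq_sqrt_cinner)
  ultimately show ?thesis by (simp add: complex_eq_iff)
qed

lemma cinner_self_eq_0_iff [simp]: "cinner x x = 0 \<longleftrightarrow> x = (0 :: 'a::complex_hilbert_space)"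
  by (simp add: cinner_self)

lemma norm_scaleC: "norm (c *\<^sub>C x :: 'a::complex_hilbert_space) = cmod c * norm x"
proof -
  have "cinner (c *\<^sub>C x) (c *\<^sub>C x) = c * cnj c * cinner x x"
    by (simp add: cinner_scaleC_left cinner_scaleC_right del: cinner_self_eq_0_iff)
  also have "\<dots> = complex_of_real ((cmod c * norm x)\<^sup>2)"
    by (simp only: cinner_self complex_norm_square[symmetric] of_real_mult[symmetric] power_mult_distrib)
  finally have "cinner (c *\<^sub>C x) (c *\<^sub>C x) = complex_of_real ((cmod c * norm x)\<^sup>2)" .
  then have "(norm (c *\<^sub>C x))\<^sup>2 = (cmod c * norm x)\<^sup>2" using cinner_self of_real_eq_iff by metis
  then show ?thesis by (simp add: power2_eq_iff_nonneg)
qed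

section \<open>Finite orthonormal families: Bessel, Cauchy-Schwarz, Gram-Schmidt\<close>

definition orthonormal_on :: "'i set \<Rightarrow> ('i \<Rightarrow> 'a::complex_hilbert_space) \<Rightarrow> bool" where
  "orthonormal_on I v \<longleftrightarrow> (\<forall>i\<in>I. \<forall>j\<in>I. cinner (v i) (v j) = (if i = j then 1 else 0))"

lemma orthonormal_onD:
  "orthonormal_on I v \<Longrightarrow> i \<in> I \<Longrightarrow> j \<in> I \<Longrightarrow> cinner (v i) (v j) = (if i = j then 1 else 0)"
  by (simp add: orthonormal_on_def)

lemma orthonormal_on_subset: "orthonormal_on I v \<Longrightarrow> J \<subseteq> I \<Longrightarrow> orthonormal_on J v"
  unfolding orthonormal_on_def by blast

lemma cinner_orthonormal_sum:
  assumes "finite I" "orthonormal_on I v" "j \<in> I"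
  shows "cinner (\<Sum>i\<in>I. b i *\<^sub>C v i) (v j) = b j"
proof -
  have "cinner (\<Sum>i\<in>I. b i *\<^sub>C v i) (v j) = (\<Sum>i\<in>I. if i = j then b i else 0)"
    unfolding cinner_sum_left cinner_scaleC_left
    using assms by (intro sum.cong refl) (simp add: orthonormal_onD)
  then show ?thesis using assms by simp
qed

text \<open>Completing the square. Taking for \<open>b\<close> the coefficients of \<open>x\<close>
  gives Bessel, those of a vector in the span give the best approximation property, and
  \<open>x = 0\<close> gives the norm of an orthonormal sum.\<close>

lemma norm_diff_orthonormal_sum:
  fixes x :: "'a::complex_hilbert_space"
  assumes "finite I" "orthonormal_on I v"
  shows "(norm (x - (\<Sum>i\<in>I. b i *\<^sub>C v i)))\<^sup>2
    = (norm x)\<^sup>2 - (\<Sum>i\<in>I. (cmod (cinner x (v i)))\<^sup>2) + (\<Sum>i\<in>I. (cmod (cinner x (v i) - b i))\<^sup>2)"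
proof -
  define y where "y = (\<Sum>i\<in>I. b i *\<^sub>C v i)"
  have yv: "cinner y (v i) = b i" if "i \<in> I" for i
    unfolding y_def by (rule cinner_orthonormal_sum[OF assms that])
  have "cinner z y = (\<Sum>i\<in>I. cnj (b i) * cinner z (v i))" for z
    by (simp add: y_def cinner_sum_right cinner_scaleC_right)
  then have xy: "cinner x y = (\<Sum>i\<in>I. cnj (b i) * cinner x (v i))"
    and yy: "cinner y y = (\<Sum>i\<in>I. cnj (b i) * b i)"
    by (simp_all add: yv)
  have yx: "cinner y x = (\<Sum>i\<in>I. b i * cnj (cinner x (v i)))"
    using cinner_commute[of y x] by (simp add: xy)
  have "cinner (x - y) (x - y) = cinner x x - cinner x y - cinner y x + cinner y y"
    by (simp add: cinner_diff_left cinner_diff_right)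
  also have "\<dots> = cinner x x - (\<Sum>i\<in>I. cinner x (v i) * cnj (cinner x (v i)))
      + (\<Sum>i\<in>I. (cinner x (v i) - b i) * cnj (cinner x (v i) - b i))"
    unfolding xy yx yy by (simp add: sum.distrib sum_subtractf algebra_simps)
  finally have "complex_of_real ((norm (x - y))\<^sup>2) = complex_of_real
      ((norm x)\<^sup>2 - (\<Sum>i\<in>I. (cmod (cinner x (v i)))\<^sup>2) + (\<Sum>i\<in>I. (cmod (cinner x (v i) - b i))\<^sup>2))"
    by (simp add: cinner_self complex_norm_square del: complex_cnj_diff of_real_power)
  then show ?thesis unfolding y_def of_real_eq_iff .
qed

lemma bessel_inequality:
  assumes "finite I" "orthonormal_on I v"
  shows "(\<Sum>i\<in>I. (cmod (cinner x (v i)))\<^sup>2) \<le> (norm x)\<^sup>2"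
  using norm_diff_orthonormal_sum[OF assms, of x "\<lambda>i. cinner x (v i)"]
    zero_le_power2[of "norm (x - (\<Sum>i\<in>I. cinner x (v i) *\<^sub>C v i))"] by simp

text \<open>Bessel for the single unit vector \<open>u\<close> in the direction of
  \<open>y\<close>.\<close>

lemma cmod_cinner_le: "cmod (cinner x y) \<le> norm (x :: 'a::complex_hilbert_space) * norm y"
proof (cases "y = 0")
  case False
  define u where "u = complex_of_real (inverse (norm y)) *\<^sub>C y"
  have "norm u = 1" using False by (simp add: u_def norm_scaleC norm_inverse)
  then have "orthonormal_on {u} id" by (simp add: orthonormal_on_def cinner_self)
  from bessel_inequality[OF _ this, of x] have "cmod (cinner x u) \<le> norm x" by (simp add: abs_le_square_iff[symmetric])
  then show ?thesis
    using False by (simp add: u_def cinner_scaleC_right norm_mult field_simps norm_divide)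
qed simp

lemma bounded_linear_cinner_left: "bounded_linear (\<lambda>x. cinner x (y :: 'a::complex_hilbert_space))"
  by (rule bounded_linear_intro[where K = "norm y"])
    (simp_all add: cinner_add_left cinner_scaleC_left scaleR_eq_scaleC scaleR_conv_of_real cmod_cinner_le)

lemma bounded_linear_scaleC: "bounded_linear (\<lambda>x :: 'a::complex_hilbert_space. c *\<^sub>C x)"
  by (rule bounded_linear_intro[where K = "cmod c"])
    (simp_all add: scaleC_add_right scaleR_eq_scaleC scaleC_scaleC norm_scaleC mult.commute)

lemma in_cspan_orthonormal:
  assumes "finite I" "orthonormal_on I v" "x \<in> cspan (v ` I)"
  shows "x = (\<Sum>i\<in>I. cinner x (v i) *\<^sub>C v i)"
proof -
  have "cspan (v ` I) \<subseteq> {x. x = (\<Sum>i\<in>I. cinner x (v i) *\<^sub>C v i)}"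
  proof (rule complex_vector.span_minimal)
    have "v j = (\<Sum>i\<in>I. cinner (v j) (v i) *\<^sub>C v i)" if "j \<in> I" for j
    proof -
      have "(\<Sum>i\<in>I. cinner (v j) (v i) *\<^sub>C v i) = (\<Sum>i\<in>I. if i = j then v i else 0)"
        using assms that by (intro sum.cong refl) (auto simp: orthonormal_onD)
      then show ?thesis using assms that by simp
    qed
    then show "v ` I \<subseteq> {x. x = (\<Sum>i\<in>I. cinner x (v i) *\<^sub>C v i)}" by blast
    show "complex_vector.subspace {x. x = (\<Sum>i\<in>I. cinner x (v i) *\<^sub>C v i)}"
      by (auto simp: complex_vector.subspace_def cinner_add_left scaleC_add_left sum.distrib
          cinner_scaleC_left complex_vector.scale_sum_right scaleC_scaleC)
        (metis (no_types, lifting) complex_vector.scale_sum_right scaleC_scaleC sum.cong)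
  qed
  then show ?thesis using assms by blast
qed

lemma sum_scaleC_in_cspan: "(\<Sum>i\<in>I. b i *\<^sub>C v i) \<in> cspan (v ` I)"
  by (intro complex_vector.span_sum complex_vector.span_scale complex_vector.span_base imageI)

lemma orthonormal_on_inj_on:
  assumes "orthonormal_on I v" shows "inj_on v I"
proof (rule inj_onI)
  fix i j assume "i \<in> I" "j \<in> I" "v i = v j"
  then show "i = j" using orthonormal_onD[OF assms, of i i] orthonormal_onD[OF assms, of i j]
    by (auto split: if_splits)
qed

lemma orthonormal_on_independent:
  assumes "finite I" "orthonormal_on I v"
  shows "complex_vector.independent (v ` I)"
proof (rule complex_vector.independent_if_scalars_zero)
  fix f x assume 0: "(\<Sum>x\<in>v ` I. f x *\<^sub>C x) = 0" and "x \<in> v ` I"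
  then obtain j where j: "j \<in> I" "x = v j" by blast
  have "(\<Sum>i\<in>I. f (v i) *\<^sub>C v i) = 0"
    using 0 by (simp add: sum.reindex[OF orthonormal_on_inj_on[OF assms(2)]])
  then show "f x = 0" using cinner_orthonormal_sum[OF assms j(1), of "\<lambda>i. f (v i)"] j by simp
qed (use assms in simp)

lemma cdim_cspan_orthonormal:
  assumes "finite I" "orthonormal_on I v"
  shows "cdim (cspan (v ` I)) = card I"
  using complex_vector.dim_span_eq_card_independent[OF orthonormal_on_independent[OF assms]]
    card_image[OF orthonormal_on_inj_on[OF assms(2)]] by simp

text \<open>A basis of \<open>V\<close> is finite, being independent in the span of a finite set. So
  \<open>cdim V\<close> is the size of a finite spanning set, and the exchange bound applies to
  \<open>B\<close>.\<close>

lemma card_le_cdim: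
  assumes "finite_dimensional V" "B \<subseteq> V" "complex_vector.independent B"
  shows "finite B \<and> card B \<le> cdim V"
proof -
  obtain C where C: "C \<subseteq> V" "complex_vector.independent C" "V \<subseteq> cspan C" "card C = cdim V"
    using complex_vector.basis_exists by blast
  obtain S where S: "finite S" "V \<subseteq> cspan S" using assms by (auto simp: finite_dimensional_def)
  have "finite C" using complex_vector.independent_span_bound[OF S(1) C(2)] C S by blast
  from complex_vector.independent_span_bound[OF this assms(3)] show ?thesis
    using assms C by auto
qed

text \<open>Gram-Schmidt, run for \<open>cdim V\<close> steps: it does not stop earlier because
  fewer vectors cannot span \<open>V\<close>, and nothing is left over because \<open>V\<close> has
  no \<open>cdim V + 1\<close> independent vectors.\<close>

lemma exists_orthonormal_basis_of_subspace:
  fixes V :: "'a::complex_hilbert_space set"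
  assumes V: "complex_vector.subspace V" "finite_dimensional V"
  shows "\<exists>v. orthonormal_on {..<cdim V} v \<and> v ` {..<cdim V} \<subseteq> V \<and> V \<subseteq> cspan (v ` {..<cdim V})"
proof -
  have extend: "\<exists>y\<in>V. cinner y y = 1 \<and> (\<forall>i\<in>I. cinner y (v i) = 0)"
    if I: "finite I" "orthonormal_on I v" "v ` I \<subseteq> V" and x: "x \<in> V" "x \<notin> cspan (v ` I)"
    for I :: "nat set" and v x
  proof -
    define z where "z = x - (\<Sum>i\<in>I. cinner x (v i) *\<^sub>C v i)"
    have "z \<noteq> 0" using x sum_scaleC_in_cspan[of "\<lambda>i. cinner x (v i)" v I] by (auto simp: z_def)
    have "z \<in> V" unfolding z_def using I x V(1)
      by (intro complex_vector.subspace_diff complex_vector.subspace_sum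
          complex_vector.subspace_scale) auto
    moreover have "cinner z (v i) = 0" if "i \<in> I" for i
      unfolding z_def cinner_diff_left cinner_orthonormal_sum[OF I(1,2) that] by simp
    moreover have "norm (complex_of_real (inverse (norm z)) *\<^sub>C z) = 1"
      using \<open>z \<noteq> 0\<close> by (simp add: norm_scaleC norm_inverse)
    ultimately show ?thesis using V(1)
      by (intro bexI[of _ "complex_of_real (inverse (norm z)) *\<^sub>C z"])
        (auto simp: cinner_self cinner_scaleC_left intro: complex_vector.subspace_scale)
  qed
  have "\<exists>v. orthonormal_on {..<k} v \<and> v ` {..<k} \<subseteq> V" if "k \<le> cdim V" for k
    using that
  proof (induction k)
    case 0
    then show ?case by (auto simp: orthonormal_on_def)
  next
    case (Suc k)
    then obtain v where v: "orthonormal_on {..<k} v" "v ` {..<k} \<subseteq> V" by auto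
    have "\<not> V \<subseteq> cspan (v ` {..<k})"
      using complex_vector.dim_le_card[of V "v ` {..<k}"] card_image_le[of "{..<k}" v] Suc.prems by force
    then obtain x where "x \<in> V" "x \<notin> cspan (v ` {..<k})" by blast
    then obtain y where y: "y \<in> V" "cinner y y = 1" "\<And>i. i < k \<Longrightarrow> cinner y (v i) = 0"
      using extend[OF finite_lessThan v] by force
    have "cinner (v i) y = 0" if "i < k" for i using y(3)[OF that] cinner_commute[of "v i" y] by simp
    then have "orthonormal_on {..<Suc k} (v(k := y))"
      using v y by (auto simp: orthonormal_on_def)
    moreover have "(v(k := y)) ` {..<Suc k} \<subseteq> V" using v y by auto
    ultimately show ?case by blast
  qed
  then obtain v where v: "orthonormal_on {..<cdim V} v" "v ` {..<cdim V} \<subseteq> V" by blast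
  have "V \<subseteq> cspan (v ` {..<cdim V})"
  proof (rule ccontr)
    assume "\<not> ?thesis"
    then obtain x where x: "x \<in> V" "x \<notin> cspan (v ` {..<cdim V})" by auto
    have "complex_vector.independent (insert x (v ` {..<cdim V}))"
      using x orthonormal_on_independent[OF finite_lessThan v(1)]
      by (intro complex_vector.independent_insertI)
    then have "card (insert x (v ` {..<cdim V})) \<le> cdim V"
      using card_le_cdim[OF V(2)] x v by auto
    moreover have "x \<notin> v ` {..<cdim V}" using x(2) by (metis complex_vector.span_base)
    ultimately show False using card_image[OF orthonormal_on_inj_on[OF v(1)]] by simp
  qed
  then show ?thesis using v by blast
qed

section \<open>Infinite orthonormal families: Parseval and convergence of expansions\<close>

lemma orthonormal_basis_imp_orthonormal_on: "orthonormal_basis e \<Longrightarrow> orthonormal_on I e"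
  by (simp add: orthonormal_basis_def orthonormal_on_def)

text \<open>The partial sums increase and are bounded by Bessel. They come arbitrarily close because
  finite combinations of the \<open>e i\<close> approximate \<open>x\<close>, and the orthogonal
  projection approximates no worse.\<close>

lemma parseval:
  fixes x :: "'a::complex_hilbert_space"
  assumes e: "orthonormal_basis e"
  shows "(\<lambda>i. (cmod (cinner x (e i)))\<^sup>2) sums (norm x)\<^sup>2"
proof -
  note on = orthonormal_basis_imp_orthonormal_on[OF e]
  define s where "s n = (\<Sum>i<n. (cmod (cinner x (e i)))\<^sup>2)" for n
  have s_le: "s n \<le> (norm x)\<^sup>2" for n unfolding s_def by (rule bessel_inequality[OF _ on]) simp
  have mono: "s m \<le> s n" if "m \<le> n" for m n
    unfolding s_def using that by (intro sum_mono2) auto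
  have "\<exists>n0. \<forall>n\<ge>n0. \<bar>s n - (norm x)\<^sup>2\<bar> < \<delta>" if "0 < \<delta>" for \<delta>
  proof -
    have "x \<in> closure (cspan (range e))" using e by (simp add: orthonormal_basis_def)
    then have "\<exists>y\<in>cspan (range e). dist y x < sqrt \<delta>"
      using that by (simp add: closure_approachable)
    then obtain y where y: "y \<in> cspan (range e)" "dist y x < sqrt \<delta>" by blast
    \<comment> \<open>The spans of initial segments increase, so their union is a subspace, and
      every vector of the full span lies in one of them.\<close>
    have "cspan (range e) = (\<Union>n. cspan (e ` {..<n}))"
    proof
      have "complex_vector.subspace (\<Union>n. cspan (e ` {..<n}))"
      proof (unfold complex_vector.subspace_def, intro conjI ballI allI)
        show "0 \<in> (\<Union>n. cspan (e ` {..<n}))" using complex_vector.span_zero by blast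
        fix y assume y: "y \<in> (\<Union>n. cspan (e ` {..<n}))"
        show "c *\<^sub>C y \<in> (\<Union>n. cspan (e ` {..<n}))" for c
          using y complex_vector.span_scale by blast
        fix z assume z: "z \<in> (\<Union>n. cspan (e ` {..<n}))"
        obtain m n where "y \<in> cspan (e ` {..<m})" "z \<in> cspan (e ` {..<n})" using y z by auto
        then have "y \<in> cspan (e ` {..<max m n})" "z \<in> cspan (e ` {..<max m n})"
          using complex_vector.span_mono[of "e ` {..<m}" "e ` {..<max m n}"]
            complex_vector.span_mono[of "e ` {..<n}" "e ` {..<max m n}"] by fastforce+
        then show "y + z \<in> (\<Union>n. cspan (e ` {..<n}))" using complex_vector.span_add by blast
      qed
      moreover have "e i \<in> (\<Union>n. cspan (e ` {..<n}))" for i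
        by (auto intro!: exI[of _ "Suc i"] complex_vector.span_base)
      ultimately show "cspan (range e) \<subseteq> (\<Union>n. cspan (e ` {..<n}))"
        by (intro complex_vector.span_minimal) auto
      show "(\<Union>n. cspan (e ` {..<n})) \<subseteq> cspan (range e)"
        by (intro UN_least complex_vector.span_mono) auto
    qed
    then obtain n0 where n0: "y \<in> cspan (e ` {..<n0})" using y by auto
    have "(norm x)\<^sup>2 - s n0 \<le> (norm (x - y))\<^sup>2"
      using norm_diff_orthonormal_sum[OF _ on, of "{..<n0}" x "\<lambda>i. cinner y (e i)"]
        in_cspan_orthonormal[OF _ on n0]
      by (simp add: s_def sum_nonneg)
    also have "\<dots> < (sqrt \<delta>)\<^sup>2"
      using y by (intro power_strict_mono) (auto simp: dist_norm norm_minus_commute)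
    finally have "(norm x)\<^sup>2 - s n0 < \<delta>" using that by simp
    then show ?thesis using mono s_le by (intro exI[of _ n0]) (smt (verit))
  qed
  then have "s \<longlonglongrightarrow> (norm x)\<^sup>2" by (intro LIMSEQ_I) simp
  then show ?thesis by (simp add: sums_def s_def[abs_def])
qed

text \<open>By Pythagoras the squared norm of a block of this series is a block of the series of
  squares, so the partial sums are Cauchy; completeness of the space provides the limit.\<close>

lemma orthonormal_on_sums_exists:
  fixes e :: "nat \<Rightarrow> 'a::complex_hilbert_space"
  assumes e: "orthonormal_on UNIV e" and u: "summable (\<lambda>i. (cmod (u i))\<^sup>2)"
  shows "\<exists>v. (\<lambda>i. u i *\<^sub>C e i) sums v"
proof -
  have on: "orthonormal_on I e" for I using e by (auto simp: orthonormal_on_def)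
  have norm_sum: "(norm (\<Sum>i\<in>I. u i *\<^sub>C e i))\<^sup>2 = (\<Sum>i\<in>I. (cmod (u i))\<^sup>2)" if "finite I" for I
    using norm_diff_orthonormal_sum[OF that on, of 0 u] by (simp add: norm_minus_commute)
  have "summable (\<lambda>i. u i *\<^sub>C e i)"
  proof (rule summable_Cauchy[THEN iffD2], intro allI impI)
    fix \<delta> :: real assume "0 < \<delta>"
    then obtain N where N: "\<And>m n. m \<ge> N \<Longrightarrow> norm (\<Sum>i\<in>{m..<n}. (cmod (u i))\<^sup>2) < \<delta>\<^sup>2"
      using u[unfolded summable_Cauchy, rule_format, of "\<delta>\<^sup>2"] by auto
    have "norm (\<Sum>i\<in>{m..<n}. u i *\<^sub>C e i) < \<delta>" if "m \<ge> N" for m n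
    proof (rule power2_less_imp_less)
      show "(norm (\<Sum>i = m..<n. u i *\<^sub>C e i))\<^sup>2 < \<delta>\<^sup>2"
        using N[OF that, of n] by (simp add: norm_sum sum_nonneg)
    qed (use \<open>0 < \<delta>\<close> in simp)
    then show "\<exists>N. \<forall>m\<ge>N. \<forall>n. norm (\<Sum>i\<in>{m..<n}. u i *\<^sub>C e i) < \<delta>" by blast
  qed
  then show ?thesis by (auto intro: summable_sums)
qed

subsection \<open>Finite rank operators\<close>

lemma finite_dimensional_cspan: "finite B \<Longrightarrow> V \<subseteq> cspan B \<Longrightarrow> finite_dimensional V"
  by (auto simp: finite_dimensional_def)

lemma not_finite_dimensional_UNIV:
  assumes "orthonormal_basis (e :: nat \<Rightarrow> 'a::complex_hilbert_space)"
  shows "\<not> finite_dimensional (UNIV :: 'a set)"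
proof
  assume fd: "finite_dimensional (UNIV :: 'a set)"
  define n where "n = Suc (cdim (UNIV :: 'a set))"
  have on: "orthonormal_on {..<n} e" by (rule orthonormal_basis_imp_orthonormal_on[OF assms])
  have "card (e ` {..<n}) \<le> cdim (UNIV :: 'a set)"
    using card_le_cdim[OF fd _ orthonormal_on_independent[OF _ on]] by simp
  then show False using card_image[OF orthonormal_on_inj_on[OF on]] by (simp add: n_def)
qed

text \<open>For orthonormal \<open>v\<close>, the operator with eigenvector \<open>v k\<close> for
  \<open>b k\<close> that vanishes on the orthogonal complement. Complex \<open>b\<close> are
  allowed because the resolvent is built from such operators too.\<close>

definition diag_op :: "('k \<Rightarrow> 'a::complex_hilbert_space) \<Rightarrow> 'k set \<Rightarrow> ('k \<Rightarrow> complex) \<Rightarrow> 'a \<Rightarrow> 'a" where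
  "diag_op v K b x = (\<Sum>k\<in>K. (b k * cinner x (v k)) *\<^sub>C v k)"

lemma diag_op_add: "diag_op v K b (x + y) = diag_op v K b x + diag_op v K b y"
  by (simp add: diag_op_def cinner_add_left distrib_left scaleC_add_left sum.distrib)

lemma diag_op_scaleC: "diag_op v K b (c *\<^sub>C x) = c *\<^sub>C diag_op v K b x"
  by (simp add: diag_op_def cinner_scaleC_left complex_vector.scale_sum_right scaleC_scaleC
      mult.left_commute)

lemma norm_diag_op_le: "norm (diag_op v K b x) \<le> norm x * (\<Sum>k\<in>K. cmod (b k) * norm (v k) * norm (v k))"
proof -
  have "norm (diag_op v K b x) \<le> (\<Sum>k\<in>K. norm ((b k * cinner x (v k)) *\<^sub>C v k))"
    unfolding diag_op_def by (rule norm_sum)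
  also have "\<dots> \<le> (\<Sum>k\<in>K. cmod (b k) * (norm x * norm (v k)) * norm (v k))"
    unfolding norm_scaleC norm_mult
    by (intro sum_mono mult_right_mono mult_left_mono cmod_cinner_le) auto
  finally show ?thesis by (simp add: sum_distrib_left algebra_simps)
qed

lemma bounded_operator_diag_op: "bounded_operator (diag_op v K b)"
  unfolding bounded_operator_def
  by (intro conjI allI diag_op_scaleC bounded_linear_intro[OF diag_op_add _ norm_diag_op_le])
    (simp add: scaleR_eq_scaleC diag_op_scaleC)

lemma self_adjoint_diag_op: "self_adjoint (diag_op v K (\<lambda>k. complex_of_real (a k)))"
  unfolding self_adjoint_def
proof (intro conjI bounded_operator_diag_op allI)
  fix x y
  have "cnj (cinner y (v k)) = cinner (v k) y" for k using cinner_commute[of "v k" y] by simp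
  then show "cinner (diag_op v K (\<lambda>k. complex_of_real (a k)) x) y
      = cinner x (diag_op v K (\<lambda>k. complex_of_real (a k)) y)"
    by (simp add: diag_op_def cinner_sum_left cinner_sum_right cinner_scaleC_left
        cinner_scaleC_right algebra_simps)
qed

lemma diag_op_in_cspan: "diag_op v K b x \<in> cspan (v ` K)"
  unfolding diag_op_def by (rule sum_scaleC_in_cspan)

lemma finite_rank_diag_op: "finite K \<Longrightarrow> finite_rank (diag_op v K b)"
  unfolding finite_rank_def
  by (rule finite_dimensional_cspan[of "v ` K"]) (auto simp: diag_op_in_cspan)

lemma cinner_diag_op:
  assumes "finite K" "orthonormal_on K v" "k \<in> K"
  shows "cinner (diag_op v K b x) (v k) = b k * cinner x (v k)"
  unfolding diag_op_def by (rule cinner_orthonormal_sum[OF assms])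

lemma diag_op_basis:
  assumes "finite K" "orthonormal_on K v" "k \<in> K"
  shows "diag_op v K b (v k) = b k *\<^sub>C v k"
proof -
  have "diag_op v K b (v k) = (\<Sum>l\<in>K. if l = k then b k *\<^sub>C v k else 0)"
    unfolding diag_op_def using assms by (intro sum.cong refl) (auto simp: orthonormal_onD)
  then show ?thesis using assms by simp
qed

lemma diag_op_diag_op:
  assumes "finite K" "orthonormal_on K v"
  shows "diag_op v K b (diag_op v K c x) = diag_op v K (\<lambda>k. b k * c k) x"
  unfolding diag_op_def[of _ _ b] diag_op_def[of _ _ "\<lambda>k. b k * c k"]
  using assms by (intro sum.cong refl) (simp add: cinner_diag_op mult.assoc)

lemma bounded_operator_diff:
  assumes "bounded_operator E" "bounded_operator F"
  shows "bounded_operator (\<lambda>x. E x - F x)"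
  using assms by (auto simp: bounded_operator_def bounded_linear_sub complex_vector.scale_right_diff_distrib)

lemma bounded_operator_scaleC: "bounded_operator (\<lambda>x. c *\<^sub>C x)"
  by (simp add: bounded_operator_def bounded_linear_scaleC scaleC_scaleC mult.commute)

section \<open>Kernels, multiplicities and spectrum of diagonal operators\<close>

lemma diag_op_minus_scaleC_eq_0_iff:
  assumes "finite K" "orthonormal_on K v" "\<mu> \<noteq> 0"
  shows "diag_op v K b x - \<mu> *\<^sub>C x = 0 \<longleftrightarrow> x \<in> cspan (v ` {k \<in> K. b k = \<mu>})"
proof
  assume "diag_op v K b x - \<mu> *\<^sub>C x = 0"
  then have eq: "diag_op v K b x = \<mu> *\<^sub>C x" by simp
  \<comment> \<open>Comparing coefficients at \<open>v k\<close>: only components with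
    \<open>b k = \<mu>\<close> survive. As \<open>\<mu> \<noteq> 0\<close>, the vector
    \<open>x\<close> is a multiple of its image, hence the sum of these components.\<close>
  have z: "cinner x (v k) = 0" if "k \<in> K" "b k \<noteq> \<mu>" for k
    using cinner_diag_op[OF assms(1,2) that(1), of b x] that by (simp add: eq cinner_scaleC_left)
  have "x = (1 / \<mu>) *\<^sub>C \<mu> *\<^sub>C x" using assms by (simp add: scaleC_scaleC scaleC_one)
  also have "\<dots> = (1 / \<mu>) *\<^sub>C diag_op v K b x" by (simp add: eq)
  also have "diag_op v K b x = (\<Sum>k\<in>{k \<in> K. b k = \<mu>}. (b k * cinner x (v k)) *\<^sub>C v k)"
    unfolding diag_op_def using assms z by (intro sum.mono_neutral_right) auto
  also have "(1 / \<mu>) *\<^sub>C \<dots> \<in> cspan (v ` {k \<in> K. b k = \<mu>})"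
    by (intro complex_vector.span_scale sum_scaleC_in_cspan)
  finally show "x \<in> cspan (v ` {k \<in> K. b k = \<mu>})" .
next
  assume "x \<in> cspan (v ` {k \<in> K. b k = \<mu>})"
  moreover have "cspan (v ` {k \<in> K. b k = \<mu>}) \<subseteq> {x. diag_op v K b x - \<mu> *\<^sub>C x = 0}"
  proof (rule complex_vector.span_minimal)
    show "v ` {k \<in> K. b k = \<mu>} \<subseteq> {x. diag_op v K b x - \<mu> *\<^sub>C x = 0}"
      using assms by (auto simp: diag_op_basis)
    show "complex_vector.subspace {x. diag_op v K b x - \<mu> *\<^sub>C x = 0}"
      using diag_op_scaleC[of v K b 0 0]
      by (auto simp: complex_vector.subspace_def diag_op_add diag_op_scaleC scaleC_add_right
          scaleC_scaleC mult.commute)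
  qed
  ultimately show "diag_op v K b x - \<mu> *\<^sub>C x = 0" by blast
qed

lemma eigenvalue_in_spectrum:
  assumes "w \<noteq> 0" "E w = \<mu> *\<^sub>C w"
  shows "\<mu> \<in> spectrum E"
proof -
  have False if R: "bounded_operator R" "\<And>x. R (E x - \<mu> *\<^sub>C x) = x" for R
  proof -
    have "R 0 = 0" using R(1) by (simp add: bounded_operator_def linear_simps)
    then show False using R(2)[of w] assms by simp
  qed
  then show ?thesis by (auto simp: spectrum_def)
qed

lemma multiplicity_of_diag_op:
  assumes "finite K" "orthonormal_on K v" "\<mu> \<noteq> 0"
  shows "multiplicity_of (diag_op v K b) \<mu> = enat (card {k \<in> K. b k = \<mu>})"
proof -
  let ?L = "{k \<in> K. b k = \<mu>}"
  have L: "finite ?L" "orthonormal_on ?L v" using assms orthonormal_on_subset[of K v ?L] by auto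
  have "{x. diag_op v K b x - \<mu> *\<^sub>C x = 0} = cspan (v ` ?L)"
    using diag_op_minus_scaleC_eq_0_iff[OF assms] by blast
  moreover have "finite_dimensional (cspan (v ` ?L))"
    using L by (intro finite_dimensional_cspan[of "v ` ?L"]) auto
  ultimately show ?thesis
    using cdim_cspan_orthonormal[OF L] by (simp add: multiplicity_of_def edim_def)
qed

text \<open>Subtracting from \<open>x\<close> its projection to the span of the \<open>v k\<close>
  leaves a vector of the kernel, so a finite-dimensional kernel would make the whole space
  finite-dimensional.\<close>

lemma not_finite_dimensional_kernel_diag_op:
  fixes v :: "'k \<Rightarrow> 'a::complex_hilbert_space"
  assumes "finite K" "orthonormal_on K v" "\<not> finite_dimensional (UNIV :: 'a set)"
  shows "\<not> finite_dimensional {x. diag_op v K b x = 0}"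
proof
  assume "finite_dimensional {x. diag_op v K b x = 0}"
  then obtain B where B: "finite B" "{x. diag_op v K b x = 0} \<subseteq> cspan B"
    by (auto simp: finite_dimensional_def)
  have "x \<in> cspan (B \<union> v ` K)" for x
  proof -
    define y where "y = diag_op v K (\<lambda>_. 1) x"
    have "diag_op v K b (x - y) + diag_op v K b y = diag_op v K b x"
      by (simp add: diag_op_add[symmetric])
    moreover have "diag_op v K b y = diag_op v K b x"
      unfolding y_def diag_op_diag_op[OF assms(1,2)] by simp
    ultimately have "x - y \<in> cspan B" using B by auto
    then have "x - y \<in> cspan (B \<union> v ` K)"
      using complex_vector.span_mono[of B "B \<union> v ` K"] by blast
    moreover have "y \<in> cspan (B \<union> v ` K)"
      using complex_vector.span_mono[of "v ` K" "B \<union> v ` K"] diag_op_in_cspan[of v K _ x]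
      by (auto simp: y_def)
    ultimately show ?thesis using complex_vector.span_add[of "x - y" _ y] by simp
  qed
  then show False using assms B finite_dimensional_cspan[of "B \<union> v ` K" UNIV] by auto
qed

text \<open>\<open>0\<close> is an eigenvalue because the kernel is infinite-dimensional. For
  \<open>\<mu>\<close> outside the right side the resolvent is explicit: it multiplies by
  \<open>1 / (b k - \<mu>)\<close> along \<open>v k\<close> and by \<open>- 1 / \<mu>\<close> on the
  orthogonal complement.\<close>

lemma spectrum_diag_op:
  fixes v :: "'k \<Rightarrow> 'a::complex_hilbert_space"
  assumes K: "finite K" "orthonormal_on K v" and inf: "\<not> finite_dimensional (UNIV :: 'a set)"
  shows "spectrum (diag_op v K b) = insert 0 (b ` K)"
proof
  have "\<exists>x. x \<noteq> 0 \<and> diag_op v K b x = 0"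
  proof (rule ccontr)
    assume "\<not> ?thesis"
    then have "{x. diag_op v K b x = 0} \<subseteq> cspan {}" by auto
    then show False
      using not_finite_dimensional_kernel_diag_op[OF assms, of b] finite_dimensional_cspan[of "{}"]
      by blast
  qed
  then obtain x where "x \<noteq> 0" "diag_op v K b x = 0 *\<^sub>C x" by auto
  then have "0 \<in> spectrum (diag_op v K b)" by (rule eigenvalue_in_spectrum)
  moreover have "b k \<in> spectrum (diag_op v K b)" if "k \<in> K" for k
  proof (rule eigenvalue_in_spectrum)
    show "v k \<noteq> 0" using orthonormal_onD[OF K(2) that that] by auto
  qed (rule diag_op_basis[OF K that])
  ultimately show "insert 0 (b ` K) \<subseteq> spectrum (diag_op v K b)" by blast
  show "spectrum (diag_op v K b) \<subseteq> insert 0 (b ` K)"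
  proof (rule subsetI, rule ccontr)
    fix \<mu> assume \<mu>: "\<mu> \<in> spectrum (diag_op v K b)" "\<mu> \<notin> insert 0 (b ` K)"
    \<comment> \<open>The scalar part acts on the whole space; the summand \<open>1 / \<mu>\<close>
      in the coefficients compensates for it along the \<open>v k\<close>.\<close>
    define R where "R x = diag_op v K (\<lambda>k. 1 / (b k - \<mu>) + 1 / \<mu>) x - (1 / \<mu>) *\<^sub>C x" for x
    have R: "bounded_operator R" unfolding R_def[abs_def]
      by (intro bounded_operator_diff bounded_operator_diag_op bounded_operator_scaleC)
    have diff: "diag_op v K c (x - y) = diag_op v K c x - diag_op v K c y" for c x y
      using diag_op_add[of v K c "x - y" y] by (simp add: algebra_simps)
    have comb: "s *\<^sub>C diag_op v K c x = diag_op v K (\<lambda>k. s * c k) x" for s c x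
      by (simp add: diag_op_def complex_vector.scale_sum_right scaleC_scaleC mult.assoc)
    have plus: "diag_op v K c x + diag_op v K c' x = diag_op v K (\<lambda>k. c k + c' k) x" for c c' x
      by (simp add: diag_op_def sum.distrib scaleC_add_left distrib_right)
    define c where "c k = 1 / (b k - \<mu>) + 1 / \<mu>" for k
    \<comment> \<open>Equivalent to \<open>(b k - \<mu>) * (c k - 1 / \<mu>) = 1\<close>; both
      inverse identities reduce to it.\<close>
    have c: "c k * b k = \<mu> * c k + 1 / \<mu> * b k" if "k \<in> K" for k
    proof -
      have "b k - \<mu> \<noteq> 0" "\<mu> \<noteq> 0" using \<mu> that by auto
      then show ?thesis by (simp add: c_def divide_simps) (simp add: algebra_simps)
    qed
    have "diag_op v K (\<lambda>k. c k * b k) x = diag_op v K (\<lambda>k. \<mu> * c k + 1 / \<mu> * b k) x" for x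
      unfolding diag_op_def by (intro sum.cong refl) (simp only: c)
    then have sum0: "diag_op v K (\<lambda>k. c k * b k) x - \<mu> *\<^sub>C diag_op v K c x
        - (1 / \<mu>) *\<^sub>C diag_op v K b x = 0" for x
      by (simp only: comb plus[symmetric] add_diff_cancel_left' diff_self)
    have Rc: "R x = diag_op v K c x - (1 / \<mu>) *\<^sub>C x" for x by (simp add: R_def c_def[abs_def])
    have one: "(1 / \<mu>) *\<^sub>C \<mu> *\<^sub>C x = x" "\<mu> *\<^sub>C (1 / \<mu>) *\<^sub>C x = x" for x
      using \<mu> by (auto simp: scaleC_scaleC scaleC_one)
    have "R (diag_op v K b x - \<mu> *\<^sub>C x) = x" for x
    proof -
      have "R (diag_op v K b x - \<mu> *\<^sub>C x) = (diag_op v K (\<lambda>k. c k * b k) x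
          - \<mu> *\<^sub>C diag_op v K c x - (1 / \<mu>) *\<^sub>C diag_op v K b x) + x"
        using \<mu>(2) by (simp add: Rc diff diag_op_diag_op[OF K] diag_op_scaleC
            complex_vector.scale_right_diff_distrib one)
      then show ?thesis by (simp add: sum0)
    qed
    moreover have "diag_op v K b (R x) - \<mu> *\<^sub>C R x = x" for x
    proof -
      have "diag_op v K b (R x) - \<mu> *\<^sub>C R x = (diag_op v K (\<lambda>k. c k * b k) x
          - \<mu> *\<^sub>C diag_op v K c x - (1 / \<mu>) *\<^sub>C diag_op v K b x) + x"
        using \<mu>(2) by (simp add: Rc diff diag_op_diag_op[OF K] diag_op_scaleC mult.commute
            complex_vector.scale_right_diff_distrib one)
      then show ?thesis by (simp add: sum0)
    qed
    ultimately show False using \<mu>(1) R by (auto simp: spectrum_def)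
  qed
qed

section \<open>Eigenvectors of finite rank self-adjoint operators\<close>

lemma self_adjoint_diff:
  assumes "self_adjoint E" "self_adjoint F"
  shows "self_adjoint (\<lambda>x. E x - F x)"
  using assms by (simp add: self_adjoint_def bounded_operator_diff cinner_diff_left cinner_diff_right)

lemma finite_rank_diff:
  assumes "finite_rank E" "finite_rank F"
  shows "finite_rank (\<lambda>x. E x - F x)"
proof -
  obtain B C where BC: "finite B" "range E \<subseteq> cspan B" "finite C" "range F \<subseteq> cspan C"
    using assms by (auto simp: finite_rank_def finite_dimensional_def)
  have "E x - F x \<in> cspan (B \<union> C)" for x
    using BC complex_vector.span_mono[of B "B \<union> C"] complex_vector.span_mono[of C "B \<union> C"]
    by (intro complex_vector.span_diff) auto
  then show ?thesis using BC unfolding finite_rank_def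
    by (intro finite_dimensional_cspan[of "B \<union> C"]) auto
qed

text \<open>Coefficients are attached to indices rather than vectors, because \<open>f\<close> may
  repeat values.\<close>

lemma in_cspan_image_imp_sum:
  assumes "finite I" "x \<in> cspan (f ` I)"
  shows "\<exists>b. x = (\<Sum>i\<in>I. b i *\<^sub>C f i)"
proof -
  have "cspan (f ` I) \<subseteq> range (\<lambda>b. \<Sum>i\<in>I. b i *\<^sub>C f i)"
  proof (rule complex_vector.span_minimal)
    show "f ` I \<subseteq> range (\<lambda>b. \<Sum>i\<in>I. b i *\<^sub>C f i)"
    proof clarify
      fix i assume "i \<in> I"
      then have "(\<Sum>j\<in>I. (if j = i then 1 else 0) *\<^sub>C f j) = f i"
        using assms(1) by (simp add: if_distrib[of "\<lambda>c. c *\<^sub>C _"] scaleC_one cong: if_cong)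
      then show "f i \<in> range (\<lambda>b. \<Sum>i\<in>I. b i *\<^sub>C f i)"
        by (intro range_eqI[of _ _ "\<lambda>j. if j = i then 1 else 0"]) (rule sym)
    qed
    show "complex_vector.subspace (range (\<lambda>b. \<Sum>i\<in>I. b i *\<^sub>C f i))"
      unfolding complex_vector.subspace_def
    proof (intro conjI ballI allI)
      show "0 \<in> range (\<lambda>b. \<Sum>i\<in>I. b i *\<^sub>C f i)" by (rule range_eqI[of _ _ "\<lambda>_. 0"]) simp
      fix x assume "x \<in> range (\<lambda>b. \<Sum>i\<in>I. b i *\<^sub>C f i)"
      then obtain b where b: "x = (\<Sum>i\<in>I. b i *\<^sub>C f i)" by blast
      show "c *\<^sub>C x \<in> range (\<lambda>b. \<Sum>i\<in>I. b i *\<^sub>C f i)" for c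
        by (rule range_eqI[of _ _ "\<lambda>i. c * b i"])
          (simp add: b complex_vector.scale_sum_right scaleC_scaleC)
      fix y assume "y \<in> range (\<lambda>b. \<Sum>i\<in>I. b i *\<^sub>C f i)"
      then obtain b' where b': "y = (\<Sum>i\<in>I. b' i *\<^sub>C f i)" by blast
      show "x + y \<in> range (\<lambda>b. \<Sum>i\<in>I. b i *\<^sub>C f i)"
        by (rule range_eqI[of _ _ "\<lambda>i. b i + b' i"])
          (simp add: b b' scaleC_add_left sum.distrib)
    qed
  qed
  then show ?thesis using assms by blast
qed

text \<open>Among the nonzero polynomials annihilating a fixed nonzero vector of the range,
  take one of least degree and split off a linear factor.\<close>

lemma finite_rank_eigenvector:
  fixes F :: "'a::complex_hilbert_space \<Rightarrow> 'a"
  assumes F: "self_adjoint F" "finite_rank F" and x0: "F x0 \<noteq> 0"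
  shows "\<exists>w \<mu>. w \<noteq> 0 \<and> \<mu> \<noteq> 0 \<and> F w = \<mu> *\<^sub>C w"
proof -
  have "linear F" and F_scale: "F (c *\<^sub>C x) = c *\<^sub>C F x" for c x
    using F(1) by (auto simp: self_adjoint_def bounded_operator_def bounded_linear.linear)
  note F_lin = linear_add[OF \<open>linear F\<close>] linear_sum[OF \<open>linear F\<close>] linear_0[OF \<open>linear F\<close>] F_scale
  \<comment> \<open>The shift by one puts every \<open>z n\<close>, including \<open>z 0\<close>,
    into the range of \<open>F\<close>.\<close>
  define z where "z n = (F ^^ Suc n) x0" for n
  have z_Suc: "z (Suc n) = F (z n)" for n by (simp add: z_def)
  have z_range: "z n \<in> range F" for n by (simp add: z_def)
  \<comment> \<open>Otherwise arbitrarily many of the \<open>z n\<close> would be independent,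
    exceeding the dimension of the range.\<close>
  have "\<exists>N. z N \<in> cspan (z ` {..<N})"
  proof (rule ccontr)
    assume "\<not> ?thesis"
    then have neg: "z N \<notin> cspan (z ` {..<N})" for N by blast
    have "complex_vector.independent (z ` {..<N}) \<and> card (z ` {..<N}) = N" for N
    proof (induction N)
      case (Suc N)
      have "z N \<notin> z ` {..<N}" using neg[of N] complex_vector.span_base[of "z N" "z ` {..<N}"] by blast
      then show ?case using Suc.IH complex_vector.independent_insertI[OF neg[of N]]
        by (simp add: lessThan_Suc)
    qed (simp add: complex_vector.independent_empty)
    then have "N \<le> cdim (range F)" for N
      using card_le_cdim[of "range F" "z ` {..<N}"] F(2) z_range
      by (auto simp: finite_rank_def image_subset_iff)
    then show False using not_less_eq_eq by blast
  qed
  then obtain N b where b: "z N = (\<Sum>i<N. b i *\<^sub>C z i)"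
    using in_cspan_image_imp_sum[OF finite_lessThan] by blast
  \<comment> \<open>For \<open>degree q \<le> N\<close>, this is the polynomial \<open>q\<close> in
    \<open>F\<close>, applied to \<open>z 0\<close>.\<close>
  define L where "L q = (\<Sum>k\<le>N. coeff q k *\<^sub>C z k)" for q
  define Q where "Q = {q. q \<noteq> 0 \<and> degree q \<le> N \<and> L q = 0}"
  have "Q \<noteq> {}"
  proof -
    define q where "q = monom 1 N - (\<Sum>i<N. monom (b i) i)"
    have coeff_q: "coeff q k = (if k = N then 1 else if k < N then - b k else 0)" for k
      by (auto simp: q_def coeff_sum)
    have "L q = 0" unfolding L_def lessThan_Suc_atMost[symmetric]
      by (simp add: coeff_q b scaleC_one sum_negf)
    moreover have "degree q \<le> N" by (rule degree_le) (simp add: coeff_q)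
    moreover have "q \<noteq> 0" using coeff_q[of N] by auto
    ultimately show ?thesis by (auto simp: Q_def)
  qed
  then obtain q where q: "q \<in> Q" and q_min: "\<And>r. r \<in> Q \<Longrightarrow> degree q \<le> degree r"
    using arg_min_nat_lemma[of "\<lambda>q. q \<in> Q" _ degree] by (metis all_not_in_conv)
  have "z 0 \<noteq> 0" using x0 by (simp add: z_def)
  have "degree q \<noteq> 0"
  proof
    assume "degree q = 0"
    then obtain c where c: "q = [:c:]" by (rule degree_eq_zeroE)
    have "L q = (\<Sum>k\<le>N. if k = 0 then c *\<^sub>C z 0 else 0)"
      unfolding L_def c by (intro sum.cong) (auto simp: coeff_pCons split: nat.split)
    then show False using q c \<open>z 0 \<noteq> 0\<close> by (simp add: Q_def)
  qed
  then obtain \<mu> where "poly q \<mu> = 0"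
    using fundamental_theorem_of_algebra[of q] constant_degree by metis
  then obtain r where r: "q = [:- \<mu>, 1:] * r" by (auto simp: poly_eq_0_iff_dvd)
  have "r \<noteq> 0" using q r by (auto simp: Q_def)
  then have deg: "degree q = Suc (degree r)" unfolding r by (subst degree_mult_eq) auto
  define w where "w = L r"
  \<comment> \<open>Otherwise \<open>r\<close> would be an annihilating polynomial of smaller
    degree.\<close>
  have "w \<noteq> 0"
  proof
    assume "w = 0"
    then have "r \<in> Q" using q deg \<open>r \<noteq> 0\<close> by (auto simp: Q_def w_def)
    then show False using q_min deg by fastforce
  qed
  \<comment> \<open>Multiplying \<open>r\<close> by the variable shifts its coefficients, which
    corresponds to applying \<open>F\<close>. Since \<open>degree r < N\<close>, nothing is lost at
    the cutoff \<open>N\<close>.\<close>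
  have "L q = F w - \<mu> *\<^sub>C w"
  proof -
    have deg_r: "degree r < N" using q deg by (simp add: Q_def)
    then have r_N: "coeff r N = 0" by (rule coeff_eq_0)
    obtain M where M: "N = Suc M" using deg_r by (cases N) auto
    have "F w = (\<Sum>k\<le>N. coeff r k *\<^sub>C z (Suc k))"
      by (simp add: w_def L_def F_lin z_Suc)
    also have "\<dots> = (\<Sum>k\<le>M. coeff r k *\<^sub>C z (Suc k))" using r_N by (simp add: M)
    also have "\<dots> = (\<Sum>k\<le>N. coeff (pCons 0 r) k *\<^sub>C z k)"
      unfolding M by (subst sum.atMost_Suc_shift) simp
    finally have "F w - \<mu> *\<^sub>C w = (\<Sum>k\<le>N. (coeff (pCons 0 r) k - \<mu> * coeff r k) *\<^sub>C z k)"
      by (simp add: w_def L_def complex_vector.scale_sum_right scaleC_scaleC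
          complex_vector.scale_left_diff_distrib sum_subtractf)
    then show ?thesis by (simp add: L_def r)
  qed
  then have Fw: "F w = \<mu> *\<^sub>C w" using q by (simp add: Q_def)
  have "w \<in> range F"
  proof -
    have "w = F (\<Sum>k\<le>N. coeff r k *\<^sub>C (F ^^ k) x0)" by (simp add: w_def L_def F_lin z_def)
    then show ?thesis by blast
  qed
  then obtain x where x: "w = F x" by blast
  \<comment> \<open>Range and kernel of a self-adjoint operator meet only in
    \<open>0\<close>.\<close>
  have "\<mu> \<noteq> 0"
  proof
    assume "\<mu> = 0"
    have "cinner w w = cinner x (F w)" using F(1) x by (simp add: self_adjoint_def)
    then show False using \<open>w \<noteq> 0\<close> Fw \<open>\<mu> = 0\<close> by simp
  qed
  then show ?thesis using Fw \<open>w \<noteq> 0\<close> by blast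
qed

text \<open>The difference \<open>F\<close> of the two operators is self-adjoint of finite rank and
  kills every \<open>v k\<close>. Were it nonzero, it would have an eigenvector \<open>w\<close> for
  a nonzero eigenvalue; \<open>w\<close> is orthogonal to all \<open>v k\<close>, hence also an
  eigenvector of \<open>E\<close>, hence in their span, hence \<open>0\<close>.\<close>

lemma eq_diag_op_if_eigenvectors_complete:
  fixes E :: "'a::complex_hilbert_space \<Rightarrow> 'a"
  assumes E: "self_adjoint E" "finite_rank E" and K: "finite K" "orthonormal_on K v"
    and eig: "\<And>k. k \<in> K \<Longrightarrow> E (v k) = complex_of_real (a k) *\<^sub>C v k"
    and complete: "\<And>w \<mu>. w \<noteq> 0 \<Longrightarrow> \<mu> \<noteq> 0 \<Longrightarrow> E w = \<mu> *\<^sub>C w \<Longrightarrow> w \<in> cspan (v ` K)"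
  shows "E = diag_op v K (\<lambda>k. complex_of_real (a k))"
proof (rule ccontr)
  define G where "G = diag_op v K (\<lambda>k. complex_of_real (a k))"
  define F where "F x = E x - G x" for x
  have F: "self_adjoint F" "finite_rank F"
    unfolding F_def[abs_def] G_def
    using E K by (intro self_adjoint_diff finite_rank_diff self_adjoint_diag_op finite_rank_diag_op; simp)+
  assume "E \<noteq> diag_op v K (\<lambda>k. complex_of_real (a k))"
  then obtain x where "F x \<noteq> 0" by (auto simp: F_def G_def)
  then obtain w \<mu> where w: "w \<noteq> 0" "\<mu> \<noteq> 0" "F w = \<mu> *\<^sub>C w"
    using finite_rank_eigenvector[OF F] by blast
  have wv: "cinner w (v k) = 0" if "k \<in> K" for k
  proof -
    have "F (v k) = 0" using diag_op_basis[OF K that] eig[OF that] by (simp add: F_def G_def)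
    then have "cinner (F w) (v k) = 0" using F(1) by (simp add: self_adjoint_def)
    then show ?thesis using w by (simp add: cinner_scaleC_left)
  qed
  then have "G w = 0" by (simp add: G_def diag_op_def)
  then have "E w = \<mu> *\<^sub>C w" using w by (simp add: F_def)
  then have "w \<in> cspan (v ` K)" using w complete by blast
  then have "w = (\<Sum>k\<in>K. cinner w (v k) *\<^sub>C v k)" by (rule in_cspan_orthonormal[OF K])
  then show False using w wv by simp
qed

subsection \<open>Diagonals of finite rank operators\<close>

text \<open>The extended sum is the supremum of its finite subsums, and \<open>max 0\<close> makes
  indices outside the summation set contribute \<open>0\<close>, so initial segments can replace
  finite subsets.\<close>

lemma infsum_pos_part_le_iff:
  fixes d :: "nat \<Rightarrow> real"
  assumes "0 \<le> B"
  shows "(\<Sum>\<^sub>\<infinity>i\<in>{i. x \<le> d i}. ennreal (d i - x)) \<le> ennreal B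
    \<longleftrightarrow> (\<forall>n. (\<Sum>i<n. max 0 (d i - x)) \<le> B)"
proof -
  define S where "S = {i. x \<le> d i}"
  have fin: "(\<Sum>i\<in>F. ennreal (d i - x)) = ennreal (\<Sum>i\<in>F. max 0 (d i - x))" if "F \<subseteq> S" for F
  proof -
    have "(\<Sum>i\<in>F. ennreal (d i - x)) = (\<Sum>i\<in>F. ennreal (max 0 (d i - x)))"
      using that by (intro sum.cong) (auto simp: S_def)
    then show ?thesis by (simp add: sum_ennreal)
  qed
  have "(\<Sum>\<^sub>\<infinity>i\<in>S. ennreal (d i - x)) \<le> ennreal B
    \<longleftrightarrow> (\<forall>F. finite F \<and> F \<subseteq> S \<longrightarrow> (\<Sum>i\<in>F. max 0 (d i - x)) \<le> B)"
    using assms by (simp add: nonneg_infsum_complete SUP_le_iff fin)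
  also have "\<dots> \<longleftrightarrow> (\<forall>n. (\<Sum>i<n. max 0 (d i - x)) \<le> B)"
  proof (intro iffI allI impI)
    fix n assume *: "\<forall>F. finite F \<and> F \<subseteq> S \<longrightarrow> (\<Sum>i\<in>F. max 0 (d i - x)) \<le> B"
    have "(\<Sum>i<n. max 0 (d i - x)) = (\<Sum>i\<in>{..<n} \<inter> S. max 0 (d i - x))"
      by (intro sum.mono_neutral_right) (auto simp: S_def)
    then show "(\<Sum>i<n. max 0 (d i - x)) \<le> B" using * by simp
  next
    fix F assume *: "\<forall>n. (\<Sum>i<n. max 0 (d i - x)) \<le> B" "finite F \<and> F \<subseteq> S"
    then obtain n where "F \<subseteq> {..<n}" using finite_nat_iff_bounded by blast
    then have "(\<Sum>i\<in>F. max 0 (d i - x)) \<le> (\<Sum>i<n. max 0 (d i - x))" by (intro sum_mono2) auto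
    then show "(\<Sum>i\<in>F. max 0 (d i - x)) \<le> B" using * by (meson order_trans)
  qed
  finally show ?thesis by (simp add: S_def)
qed

lemma infsum_neg_part_le_iff:
  fixes d :: "nat \<Rightarrow> real"
  assumes "0 \<le> B"
  shows "(\<Sum>\<^sub>\<infinity>i\<in>{i. d i \<le> x}. ennreal (x - d i)) \<le> ennreal B
    \<longleftrightarrow> (\<forall>n. (\<Sum>i<n. max 0 (x - d i)) \<le> B)"
  using infsum_pos_part_le_iff[OF assms, where x = "- x" and d = "\<lambda>i. - d i"] by (simp add: algebra_simps)

text \<open>Weight missing from a row sits on the value \<open>0\<close>, which has no positive part
  above \<open>x \<ge> 0\<close>. Convexity then bounds each entry, and summation over
  \<open>i\<close> uses the column sums.\<close>

lemma sum_pos_part_le_of_weights: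
  fixes a :: "'k \<Rightarrow> real" and q :: "'k \<Rightarrow> nat \<Rightarrow> real"
  assumes "finite K" and q: "\<And>k i. k \<in> K \<Longrightarrow> 0 \<le> q k i"
    and col: "\<And>k. k \<in> K \<Longrightarrow> q k sums 1" and row: "\<And>i. (\<Sum>k\<in>K. q k i) \<le> 1"
    and d: "\<And>i. d i = (\<Sum>k\<in>K. a k * q k i)" and x: "0 \<le> x"
  shows "(\<Sum>i<n. max 0 (d i - x)) \<le> (\<Sum>k\<in>K. max 0 (a k - x))"
proof -
  have "max 0 (d i - x) \<le> (\<Sum>k\<in>K. max 0 (a k - x) * q k i)" for i
  proof (rule max.boundedI)
    show "0 \<le> (\<Sum>k\<in>K. max 0 (a k - x) * q k i)" using q by (intro sum_nonneg mult_nonneg_nonneg) auto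
    have "d i - x \<le> d i - x * (\<Sum>k\<in>K. q k i)" using mult_left_mono[OF row[of i] x] by simp
    also have "\<dots> = (\<Sum>k\<in>K. (a k - x) * q k i)"
      by (simp add: d sum_distrib_left sum_subtractf left_diff_distrib)
    also have "\<dots> \<le> (\<Sum>k\<in>K. max 0 (a k - x) * q k i)"
      using q by (intro sum_mono mult_right_mono) auto
    finally show "d i - x \<le> (\<Sum>k\<in>K. max 0 (a k - x) * q k i)" .
  qed
  then have "(\<Sum>i<n. max 0 (d i - x)) \<le> (\<Sum>i<n. \<Sum>k\<in>K. max 0 (a k - x) * q k i)" by (rule sum_mono)
  also have "\<dots> = (\<Sum>k\<in>K. max 0 (a k - x) * (\<Sum>i<n. q k i))"
    unfolding sum_distrib_left by (rule sum.swap)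
  also have "\<dots> \<le> (\<Sum>k\<in>K. max 0 (a k - x) * 1)"
  proof (intro sum_mono mult_left_mono)
    fix k assume k: "k \<in> K"
    show "(\<Sum>i<n. q k i) \<le> 1"
      using sum_le_suminf[of "q k" "{..<n}"] col[OF k] q[OF k] by (auto simp: sums_iff)
  qed simp
  finally show ?thesis by simp
qed

lemma cmod_cinner_commute: "cmod (cinner x y) = cmod (cinner y (x :: 'a::complex_hilbert_space))"
  by (subst cinner_commute) simp

lemma cinner_diag_op_self:
  "cinner (diag_op v K (\<lambda>k. complex_of_real (a k)) x) x
    = complex_of_real (\<Sum>k\<in>K. a k * (cmod (cinner x (v k)))\<^sup>2)"
proof -
  have "cinner (v k) x = cnj (cinner x (v k))" for k by (rule cinner_commute)
  then show ?thesis
    by (simp add: diag_op_def cinner_sum_left cinner_scaleC_left complex_norm_square mult.assoc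
        del: of_real_power)
qed

lemma diag_op_diagonal_necessary:
  fixes a :: "'k \<Rightarrow> real" and d :: "nat \<Rightarrow> real"
  assumes K: "finite K" "orthonormal_on K v"
    and diag: "has_diagonal (diag_op v K (\<lambda>k. complex_of_real (a k))) d"
  shows "0 \<le> x \<Longrightarrow> (\<Sum>i<n. max 0 (d i - x)) \<le> (\<Sum>k\<in>K. max 0 (a k - x))"
    and "x \<le> 0 \<Longrightarrow> (\<Sum>i<n. max 0 (x - d i)) \<le> (\<Sum>k\<in>K. max 0 (x - a k))"
    and "d sums sum a K"
proof -
  obtain e where e: "orthonormal_basis e"
    and de: "\<And>i. cinner (diag_op v K (\<lambda>k. complex_of_real (a k)) (e i)) (e i) = complex_of_real (d i)"
    using diag by (auto simp: has_diagonal_def)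
  define q where "q k i = (cmod (cinner (e i) (v k)))\<^sup>2" for k i
  have d: "d i = (\<Sum>k\<in>K. a k * q k i)" for i
    using de[of i] unfolding cinner_diag_op_self of_real_eq_iff q_def by simp
  have q: "0 \<le> q k i" for k i by (simp add: q_def)
  have col: "q k sums 1" if "k \<in> K" for k
  proof -
    have "(norm (v k))\<^sup>2 = 1"
      using cinner_self[of "v k"] orthonormal_onD[OF K(2) that that] by (metis of_real_eq_1_iff)
    then show ?thesis using parseval[OF e, of "v k"]
      by (simp add: q_def[abs_def] cmod_cinner_commute[of "v k"])
  qed
  have row: "(\<Sum>k\<in>K. q k i) \<le> 1" for i
  proof -
    have "(norm (e i))\<^sup>2 = 1"
      using cinner_self[of "e i"] e unfolding orthonormal_basis_def by (metis of_real_eq_1_iff)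
    then show ?thesis using bessel_inequality[OF K, of "e i"] by (simp add: q_def)
  qed
  show "0 \<le> x \<Longrightarrow> (\<Sum>i<n. max 0 (d i - x)) \<le> (\<Sum>k\<in>K. max 0 (a k - x))"
    by (rule sum_pos_part_le_of_weights[OF K(1) q col row d])
  \<comment> \<open>The other side is the same estimate for \<open>- d\<close>, \<open>- a\<close>
    and \<open>- x\<close>.\<close>
  have "- d i = (\<Sum>k\<in>K. - a k * q k i)" for i by (simp add: d sum_negf)
  from sum_pos_part_le_of_weights[OF K(1) q col row this, of "- x" n]
  show "x \<le> 0 \<Longrightarrow> (\<Sum>i<n. max 0 (x - d i)) \<le> (\<Sum>k\<in>K. max 0 (x - a k))"
    by simp
  have "(\<lambda>i. \<Sum>k\<in>K. a k * q k i) sums (\<Sum>k\<in>K. a k * 1)"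
    by (intro sums_sum sums_mult col)
  then show "d sums sum a K" by (simp add: d[abs_def])
qed

text \<open>The rows \<open>U k\<close> serve as coordinates of the eigenvectors \<open>v k\<close>
  in the given basis \<open>e\<close>; orthonormality and the diagonal are then read off from
  them.\<close>

lemma diag_op_diagonal_sufficient:
  fixes a :: "'k \<Rightarrow> real" and d :: "nat \<Rightarrow> real" and e :: "nat \<Rightarrow> 'a::complex_hilbert_space"
  assumes e: "orthonormal_basis e" and finK: "finite K"
    and X: "finite X" "0 \<in> X" "\<And>k. k \<in> K \<Longrightarrow> a k \<in> X"
    and pos: "\<And>x n. x \<in> X \<Longrightarrow> 0 \<le> x \<Longrightarrow>
      (\<Sum>i<n. max 0 (d i - x)) \<le> (\<Sum>k\<in>K. max 0 (a k - x))"
    and neg: "\<And>x n. x \<in> X \<Longrightarrow> x \<le> 0 \<Longrightarrow>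
      (\<Sum>i<n. max 0 (x - d i)) \<le> (\<Sum>k\<in>K. max 0 (x - a k))"
    and trace: "d sums sum a K"
  shows "\<exists>v :: 'k \<Rightarrow> 'a. orthonormal_on K v \<and> has_diagonal (diag_op v K (\<lambda>k. complex_of_real (a k))) d"
proof -
  obtain U where U: "\<And>k l. k \<in> K \<Longrightarrow> l \<in> K \<Longrightarrow> (\<lambda>i. U k i * U l i) sums (if k = l then 1 else 0)"
    and Ud: "\<And>i. (\<Sum>k\<in>K. a k * (U k i)\<^sup>2) = d i"
    using schur_horn_sequence[OF finK X pos neg trace] by blast
  have on: "orthonormal_on UNIV e" by (rule orthonormal_basis_imp_orthonormal_on[OF e])
  have "\<exists>v. (\<lambda>i. complex_of_real (U k i) *\<^sub>C e i) sums v" if "k \<in> K" for k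
    using U[OF that that]
    by (intro orthonormal_on_sums_exists[OF on]) (auto simp: power2_eq_square sums_iff)
  then obtain v where v: "\<And>k. k \<in> K \<Longrightarrow> (\<lambda>i. complex_of_real (U k i) *\<^sub>C e i) sums v k"
    by metis
  have vy: "(\<lambda>i. complex_of_real (U k i) * cinner (e i) y) sums cinner (v k) y" if "k \<in> K" for k y
    using bounded_linear.sums[OF bounded_linear_cinner_left v[OF that], of y]
    by (simp add: cinner_scaleC_left)
  have ve: "cinner (v k) (e j) = complex_of_real (U k j)" if "k \<in> K" for k j
  proof -
    have "complex_of_real (U k i) * cinner (e i) (e j) = (if i = j then complex_of_real (U k i) else 0)" for i
      using orthonormal_onD[OF on, of i j] by simp
    then show ?thesis
      using vy[OF that, of "e j"] sums_single[of j "\<lambda>i. complex_of_real (U k i)"] sums_unique2 by simp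
  qed
  have ev: "cinner (e j) (v k) = complex_of_real (U k j)" if "k \<in> K" for k j
    using cinner_commute[of "e j" "v k"] ve[OF that] by simp
  have "cinner (v k) (v l) = (if k = l then 1 else 0)" if "k \<in> K" "l \<in> K" for k l
  proof -
    have "(\<lambda>i. complex_of_real (U k i * U l i)) sums cinner (v k) (v l)"
      using vy[OF that(1), of "v l"] that by (simp add: ev)
    then show ?thesis
      using sums_of_real[OF U[OF that], where 'a = complex] sums_unique2 by fastforce
  qed
  then have "orthonormal_on K v" by (simp add: orthonormal_on_def)
  moreover have "(\<Sum>k\<in>K. a k * (cmod (cinner (e i) (v k)))\<^sup>2) = d i" for i
    unfolding Ud[of i, symmetric] by (intro sum.cong refl) (simp add: ev)
  then have "cinner (diag_op v K (\<lambda>k. complex_of_real (a k)) (e i)) (e i) = complex_of_real (d i)" for i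
    by (simp only: cinner_diag_op_self)
  then have "has_diagonal (diag_op v K (\<lambda>k. complex_of_real (a k))) d"
    using e by (auto simp: has_diagonal_def)
  ultimately show ?thesis by blast
qed

text \<open>Orthonormal bases of the eigenspaces combine into one family, as eigenspaces for
  distinct \<open>A j\<close> are orthogonal. Every nonzero eigenvalue is in the spectrum, so its
  eigenvectors are covered. Taking \<open>0\<close> out of the spectrum allows \<open>J\<close> to
  omit an infinite-dimensional kernel.\<close>

lemma finite_rank_self_adjoint_diagonalization:
  fixes E :: "'a::complex_hilbert_space \<Rightarrow> 'a" and A :: "'j \<Rightarrow> real" and n :: "'j \<Rightarrow> nat"
  assumes E: "self_adjoint E" "finite_rank E"
    and J: "finite J" "inj_on A J"
    and mult: "\<And>j. j \<in> J \<Longrightarrow> multiplicity_of E (complex_of_real (A j)) = enat (n j)"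
    and spec: "spectrum E - {0} \<subseteq> (\<lambda>j. complex_of_real (A j)) ` J"
  shows "\<exists>v. orthonormal_on (SIGMA j:J. {..<n j}) v \<and>
    E = diag_op v (SIGMA j:J. {..<n j}) (\<lambda>k. complex_of_real (A (fst k)))"
proof -
  define V where "V j = {x. E x - complex_of_real (A j) *\<^sub>C x = 0}" for j
  define K where "K = (SIGMA j:J. {..<n j})"
  have finK: "finite K" using J by (simp add: K_def)
  have "linear E" and E_scale: "E (c *\<^sub>C x) = c *\<^sub>C E x" for c x
    using E(1) by (auto simp: self_adjoint_def bounded_operator_def bounded_linear.linear)
  note E_lin = linear_add[OF \<open>linear E\<close>] linear_0[OF \<open>linear E\<close>] E_scale
  have "\<exists>v. orthonormal_on {..<n j} v \<and> v ` {..<n j} \<subseteq> V j \<and> V j \<subseteq> cspan (v ` {..<n j})" if "j \<in> J" for j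
  proof -
    have "finite_dimensional (V j)" "cdim (V j) = n j"
      using mult[OF that] by (auto simp: multiplicity_of_def edim_def V_def split: if_splits)
    moreover have "complex_vector.subspace (V j)"
      by (auto simp: V_def complex_vector.subspace_def E_lin scaleC_add_right scaleC_scaleC mult.commute)
    ultimately show ?thesis using exists_orthonormal_basis_of_subspace[of "V j"] by metis
  qed
  then obtain v where v: "\<And>j. j \<in> J \<Longrightarrow> orthonormal_on {..<n j} (v j)"
    "\<And>j. j \<in> J \<Longrightarrow> v j ` {..<n j} \<subseteq> V j" "\<And>j. j \<in> J \<Longrightarrow> V j \<subseteq> cspan (v j ` {..<n j})"
    by metis
  have eig: "E (v j l) = complex_of_real (A j) *\<^sub>C v j l" if "j \<in> J" "l < n j" for j l
    using v(2)[OF that(1)] that by (auto simp: V_def)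
  have orth: "cinner (v i k) (v j l) = 0" if "i \<in> J" "k < n i" "j \<in> J" "l < n j" "i \<noteq> j" for i j k l
  proof -
    have "cinner (E (v i k)) (v j l) = cinner (v i k) (E (v j l))"
      using E(1) by (simp add: self_adjoint_def)
    then have "complex_of_real (A i) * cinner (v i k) (v j l) = complex_of_real (A j) * cinner (v i k) (v j l)"
      using that by (simp add: eig cinner_scaleC_left cinner_scaleC_right)
    moreover have "A i \<noteq> A j" using that J by (auto dest: inj_onD)
    ultimately show ?thesis by simp
  qed
  define w where "w k = v (fst k) (snd k)" for k
  have on: "orthonormal_on K w"
    unfolding orthonormal_on_def
  proof (intro ballI)
    fix k l assume "k \<in> K" "l \<in> K"
    then show "cinner (w k) (w l) = (if k = l then 1 else 0)"
      using orth[of "fst k" "snd k" "fst l" "snd l"] orthonormal_onD[OF v(1), of "fst k" "snd k" "snd l"]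
      by (cases "fst k = fst l") (auto simp: K_def w_def prod_eq_iff)
  qed
  have "E = diag_op w K (\<lambda>k. complex_of_real (A (fst k)))"
  proof (rule eq_diag_op_if_eigenvectors_complete[OF E finK on])
    show "E (w k) = complex_of_real (A (fst k)) *\<^sub>C w k" if "k \<in> K" for k
      using that by (auto simp: K_def w_def eig)
    fix x \<mu> assume x: "x \<noteq> 0" "\<mu> \<noteq> 0" "E x = \<mu> *\<^sub>C x"
    then have "\<mu> \<in> spectrum E" by (intro eigenvalue_in_spectrum)
    then obtain j where j: "j \<in> J" "\<mu> = complex_of_real (A j)" using spec x by blast
    then have "x \<in> V j" using x by (simp add: V_def)
    then have "x \<in> cspan (v j ` {..<n j})" using v(3) j by blast
    moreover have "v j ` {..<n j} \<subseteq> w ` K"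
      using j by (auto simp: K_def w_def intro!: image_eqI[of _ _ "(j, _)"])
    ultimately show "x \<in> cspan (w ` K)" using complex_vector.span_mono by blast
  qed
  then show ?thesis using on by (auto simp: K_def)
qed

section \<open>Characterisation of the diagonals by the eigenvalue list\<close>

theorem theorem6p6:
  fixes m p :: nat and A :: "int \<Rightarrow> real" and N :: "int \<Rightarrow> enat" and d :: "nat \<Rightarrow> real"
  assumes H: "\<exists>e :: nat \<Rightarrow> 'h::complex_hilbert_space. orthonormal_basis e"
    and "m \<ge> 1" and "p \<ge> 1"
    and "strict_mono_on {- int m..int p} A" and "A 0 = 0"
    and "\<forall>j\<in>{- int m..int p} - {0}. 1 \<le> N j \<and> N j < \<infinity>" and "N 0 = \<infinity>"
    and "\<forall>i. d i \<in> {A (- int m)..A (int p)}"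
  shows "(\<exists>E :: 'h \<Rightarrow> 'h. self_adjoint E \<and> finite_rank E \<and> has_diagonal E d \<and>
            has_eigenvalue_multiplicity_list E {- int m..int p} A N)
    \<longleftrightarrow>
      (\<forall>r\<in>{- int m..0}.
         (\<Sum>\<^sub>\<infinity>i\<in>{i. d i \<le> A r}. ennreal (A r - d i))
           \<le> ennreal (\<Sum>j=- int m..r - 1. real (the_enat (N j)) * (A r - A j))) \<and>
      (\<forall>r\<in>{0..int p}.
         (\<Sum>\<^sub>\<infinity>i\<in>{i. d i \<ge> A r}. ennreal (d i - A r))
           \<le> ennreal (\<Sum>j=r + 1..int p. real (the_enat (N j)) * (A j - A r))) \<and>
      d sums ((\<Sum>j=- int m..-1. real (the_enat (N j)) * A j)
              + (\<Sum>j=1..int p. real (the_enat (N j)) * A j))"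
proof -
  define J where "J = {- int m..int p}"
  define n where "n j = the_enat (N j)" for j
  define K where "K = (SIGMA j:J - {0}. {..<n j})"
  define a where "a k = A (fst k)" for k :: "int \<times> nat"
  have J: "finite J" "0 \<in> J" "finite (J - {0})" by (auto simp: J_def)
  have finK: "finite K" using J by (simp add: K_def)
  have less_iff: "A i < A j \<longleftrightarrow> i < j" if "i \<in> J" "j \<in> J" for i j
    using assms(4) that unfolding J_def by (rule strict_mono_on_less)
  have le_iff: "A i \<le> A j \<longleftrightarrow> i \<le> j" if "i \<in> J" "j \<in> J" for i j
    using less_iff[OF that(2,1)] by linarith
  have inj: "inj_on A J" using le_iff by (intro inj_onI) (metis order.antisym order.refl)
  have N: "N j = enat (n j)" "0 < n j" if "j \<in> J - {0}" for j
  proof -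
    have "1 \<le> N j" "N j < \<infinity>" using assms(6) that by (auto simp: J_def)
    then show "N j = enat (n j)" "0 < n j"
      by (cases "N j"; simp add: n_def one_enat_def)+
  qed
  have sum_K: "(\<Sum>k\<in>K. f (a k)) = (\<Sum>j\<in>J - {0}. real (n j) * f (A j))" for f :: "real \<Rightarrow> real"
    using J unfolding K_def a_def by (subst sum.Sigma[symmetric, unfolded split_def]) auto
  \<comment> \<open>Terms with \<open>j \<ge> r\<close> have zero positive part by monotonicity of
    \<open>A\<close>; as \<open>r \<le> 0\<close>, the index \<open>0\<close> missing from
    \<open>K\<close> is among them.\<close>
  have below: "(\<Sum>j=- int m..r - 1. real (n j) * (A r - A j)) = (\<Sum>k\<in>K. max 0 (A r - a k))"
    if r: "r \<in> {- int m..0}" for r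
  proof -
    have rJ: "r \<in> J" using r by (auto simp: J_def)
    have zero: "max 0 (A r - A j) = 0" if "j \<in> J" "r \<le> j" for j
      using le_iff[OF rJ that(1)] that by simp
    have "(\<Sum>k\<in>K. max 0 (A r - a k)) = (\<Sum>j\<in>J - {0}. real (n j) * max 0 (A r - A j))"
      by (rule sum_K)
    also have "\<dots> = (\<Sum>j=- int m..r - 1. real (n j) * max 0 (A r - A j))"
      using J r zero by (intro sum.mono_neutral_right) (auto simp: J_def)
    also have "\<dots> = (\<Sum>j=- int m..r - 1. real (n j) * (A r - A j))"
      using r le_iff[OF _ rJ] by (intro sum.cong refl) (auto simp: J_def max_def)
    finally show ?thesis by simp
  qed
  have above: "(\<Sum>j=r + 1..int p. real (n j) * (A j - A r)) = (\<Sum>k\<in>K. max 0 (a k - A r))"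
    if r: "r \<in> {0..int p}" for r
  proof -
    have rJ: "r \<in> J" using r by (auto simp: J_def)
    have zero: "max 0 (A j - A r) = 0" if "j \<in> J" "j \<le> r" for j
      using le_iff[OF that(1) rJ] that by simp
    have "(\<Sum>k\<in>K. max 0 (a k - A r)) = (\<Sum>j\<in>J - {0}. real (n j) * max 0 (A j - A r))"
      by (rule sum_K)
    also have "\<dots> = (\<Sum>j=r + 1..int p. real (n j) * max 0 (A j - A r))"
      using J r zero by (intro sum.mono_neutral_right) (auto simp: J_def)
    also have "\<dots> = (\<Sum>j=r + 1..int p. real (n j) * (A j - A r))"
      using r le_iff[OF rJ] by (intro sum.cong refl) (auto simp: J_def max_def)
    finally show ?thesis by simp
  qed
  have total: "(\<Sum>j=- int m..-1. real (n j) * A j) + (\<Sum>j=1..int p. real (n j) * A j) = sum a K"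
  proof -
    have "J - {0} = {- int m..-1} \<union> {1..int p}" by (auto simp: J_def)
    then show ?thesis using sum_K[of "\<lambda>x. x"] by (simp add: sum.union_disjoint)
  qed
  \<comment> \<open>Conditions (i) to (iii) in terms of partial sums and of \<open>K\<close>, the
    form in which the results on \<open>diag_op\<close> use them.\<close>
  have cond: "((\<forall>r\<in>{- int m..0}.
         (\<Sum>\<^sub>\<infinity>i\<in>{i. d i \<le> A r}. ennreal (A r - d i))
           \<le> ennreal (\<Sum>j=- int m..r - 1. real (n j) * (A r - A j))) \<and>
      (\<forall>r\<in>{0..int p}.
         (\<Sum>\<^sub>\<infinity>i\<in>{i. d i \<ge> A r}. ennreal (d i - A r))
           \<le> ennreal (\<Sum>j=r + 1..int p. real (n j) * (A j - A r))) \<and>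
      d sums ((\<Sum>j=- int m..-1. real (n j) * A j) + (\<Sum>j=1..int p. real (n j) * A j)))
    \<longleftrightarrow> (\<forall>r\<in>{- int m..0}. \<forall>l. (\<Sum>i<l. max 0 (A r - d i)) \<le> (\<Sum>k\<in>K. max 0 (A r - a k))) \<and>
      (\<forall>r\<in>{0..int p}. \<forall>l. (\<Sum>i<l. max 0 (d i - A r)) \<le> (\<Sum>k\<in>K. max 0 (a k - A r))) \<and>
      d sums sum a K"
    by (simp only: below above total infsum_neg_part_le_iff infsum_pos_part_le_iff
        sum_nonneg max.cobounded1 cong: ball_cong)
  show ?thesis unfolding cond[unfolded n_def]
  proof (intro iffI)
    assume "\<exists>E :: 'h \<Rightarrow> 'h. self_adjoint E \<and> finite_rank E \<and> has_diagonal E d \<and>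
      has_eigenvalue_multiplicity_list E {- int m..int p} A N"
    then obtain E :: "'h \<Rightarrow> 'h" where E: "self_adjoint E" "finite_rank E" "has_diagonal E d"
      and list: "spectrum E = (\<lambda>j. complex_of_real (A j)) ` J"
        "\<And>j. j \<in> J \<Longrightarrow> multiplicity_of E (complex_of_real (A j)) = N j"
      by (auto simp: has_eigenvalue_multiplicity_list_def J_def)
    \<comment> \<open>\<open>J - {0}\<close> carries the finite multiplicities, and since
      \<open>A 0 = 0\<close>, its eigenvalues cover the spectrum without \<open>0\<close>.\<close>
    have "\<exists>v. orthonormal_on K v \<and> E = diag_op v K (\<lambda>k. complex_of_real (A (fst k)))"
      unfolding K_def
      using E(1,2) J(3) inj list N assms(5)
      by (intro finite_rank_self_adjoint_diagonalization) (auto intro: inj_on_subset)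
    then obtain v :: "_ \<Rightarrow> 'h" where v: "orthonormal_on K v" "has_diagonal (diag_op v K (\<lambda>k. complex_of_real (a k))) d"
      using E(3) by (auto simp: a_def)
    have sign: "r \<le> 0 \<Longrightarrow> A r \<le> 0" "0 \<le> r \<Longrightarrow> 0 \<le> A r" if "r \<in> J" for r
      using le_iff[OF that J(2)] le_iff[OF J(2) that] assms(5) by auto
    show "(\<forall>r\<in>{- int m..0}. \<forall>l. (\<Sum>i<l. max 0 (A r - d i)) \<le> (\<Sum>k\<in>K. max 0 (A r - a k))) \<and>
      (\<forall>r\<in>{0..int p}. \<forall>l. (\<Sum>i<l. max 0 (d i - A r)) \<le> (\<Sum>k\<in>K. max 0 (a k - A r))) \<and>
      d sums sum a K"
      by (intro conjI ballI allI diag_op_diagonal_necessary[OF finK v] sign) (auto simp: J_def)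
  next
    assume R: "(\<forall>r\<in>{- int m..0}. \<forall>l. (\<Sum>i<l. max 0 (A r - d i)) \<le> (\<Sum>k\<in>K. max 0 (A r - a k))) \<and>
      (\<forall>r\<in>{0..int p}. \<forall>l. (\<Sum>i<l. max 0 (d i - A r)) \<le> (\<Sum>k\<in>K. max 0 (a k - A r))) \<and>
      d sums sum a K"
    obtain e :: "nat \<Rightarrow> 'h" where e: "orthonormal_basis e" using H by blast
    \<comment> \<open>The kinks are all the \<open>A r\<close>; monotonicity and
      \<open>A 0 = 0\<close> translate the sign of \<open>A r\<close> into that of
      \<open>r\<close>.\<close>
    have "\<exists>v :: _ \<Rightarrow> 'h. orthonormal_on K v \<and> has_diagonal (diag_op v K (\<lambda>k. complex_of_real (a k))) d"
    proof (rule diag_op_diagonal_sufficient[OF e finK, where X = "A ` J"])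
      show "0 \<in> A ` J" using J(2) assms(5) by force
      show "a k \<in> A ` J" if "k \<in> K" for k using that by (auto simp: a_def K_def)
      fix x l assume "x \<in> A ` J"
      then obtain r where r: "r \<in> J" "x = A r" by blast
      show "(\<Sum>i<l. max 0 (d i - x)) \<le> (\<Sum>k\<in>K. max 0 (a k - x))" if "0 \<le> x"
        using R r that le_iff[OF J(2) r(1)] assms(5) by (auto simp: J_def)
      show "(\<Sum>i<l. max 0 (x - d i)) \<le> (\<Sum>k\<in>K. max 0 (x - a k))" if "x \<le> 0"
        using R r that le_iff[OF r(1) J(2)] assms(5) by (auto simp: J_def)
    qed (use J R in auto)
    then obtain v :: "_ \<Rightarrow> 'h" where v: "orthonormal_on K v"
      and diag: "has_diagonal (diag_op v K (\<lambda>k. complex_of_real (a k))) d" by blast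
    define E where "E = diag_op v K (\<lambda>k. complex_of_real (a k))"
    note inf = not_finite_dimensional_UNIV[OF e]
    \<comment> \<open>Positive multiplicities ensure that every \<open>A j\<close> with
      \<open>j \<noteq> 0\<close> occurs in \<open>K\<close>.\<close>
    have "fst ` K = J - {0}" using N(2) by (force simp: K_def)
    then have J_eq: "J = insert 0 (fst ` K)" using J(2) by blast
    have "insert 0 ((\<lambda>k. complex_of_real (a k)) ` K) = (\<lambda>j. complex_of_real (A j)) ` J"
      by (subst J_eq) (simp add: a_def image_image assms(5))
    then have spec: "spectrum E = (\<lambda>j. complex_of_real (A j)) ` J"
      unfolding E_def by (simp add: spectrum_diag_op[OF finK v inf])
    \<comment> \<open>For \<open>j = 0\<close> the kernel has infinite dimension. For
      \<open>j \<noteq> 0\<close>, injectivity of \<open>A\<close> leaves exactly the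
      \<open>n j\<close> indices with first component \<open>j\<close>.\<close>
    have "multiplicity_of E (complex_of_real (A j)) = N j" if j: "j \<in> J" for j
    proof (cases "j = 0")
      case True
      then show ?thesis
        using not_finite_dimensional_kernel_diag_op[OF finK v inf] assms(5,7)
        by (simp add: multiplicity_of_def edim_def E_def)
    next
      case False
      have "A j \<noteq> 0" using False inj j J(2) assms(5) by (metis inj_onD)
      moreover have "{k \<in> K. complex_of_real (a k) = complex_of_real (A j)} = {j} \<times> {..<n j}"
        using inj j False by (auto simp: K_def a_def dest: inj_onD)
      ultimately show ?thesis
        using multiplicity_of_diag_op[OF finK v, of "complex_of_real (A j)"] N(1) j False
        by (simp add: E_def)
    qed
    then show "\<exists>E :: 'h \<Rightarrow> 'h. self_adjoint E \<and> finite_rank E \<and> has_diagonal E d \<and>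
      has_eigenvalue_multiplicity_list E {- int m..int p} A N"
      using self_adjoint_diag_op finite_rank_diag_op[OF finK] diag spec
      by (intro exI[of _ E]) (auto simp: E_def has_eigenvalue_multiplicity_list_def J_def)
  qed
qed

end
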